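(* The boundary $\partial\mathcal{R}_2$ of $\mathcal{R}_2$ in $\mathbb{C}$ is homeomorphic to a circle.
   Context: Let $\alpha$ be one of the two non-real roots of $x^3-2x^2+x-1$ (so $|\alpha|<1$). $\mathcal{R}_2\subset\mathbb{C}$ is the set of all $\sum_{i=2}^\infty\varepsilon_i\alpha^i$ with $\varepsilon_i\in\{0,1\}$ and $\varepsilon_i\varepsilon_{i-1}\varepsilon_{i-2}\varepsilon_{i-3}<_{lex}1101$ for all $i\ge2$, where $\varepsilon_1=\varepsilon_0=\varepsilon_{-1}=0$ and $<_{lex}$ is the lexicographic order on words. *)

theory Defs
  imports "HOL-Analysis.Analysis"
begin

text \<open>Digit sequences are indexed by the integers, so that the lexicographic condition can
  look back to the indices \<open>1, 0, -1\<close>; only the values at indices \<open>\<ge> -1\<close> matter.\<close>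

definition admissible :: "(int \<Rightarrow> nat) \<Rightarrow> bool" where
  "admissible \<epsilon> \<longleftrightarrow>
     \<epsilon> 1 = 0 \<and> \<epsilon> 0 = 0 \<and> \<epsilon> (-1) = 0 \<and>
     (\<forall>i\<ge>2. \<epsilon> i \<in> {0, 1}) \<and>
     (\<forall>i\<ge>2. ([\<epsilon> i, \<epsilon> (i - 1), \<epsilon> (i - 2), \<epsilon> (i - 3)], [1, 1, 0, 1]) \<in> lexord less_than)"

definition R2 :: "complex \<Rightarrow> complex set" where
  "R2 \<alpha> = {z. \<exists>\<epsilon>. admissible \<epsilon> \<and> (\<lambda>k. of_nat (\<epsilon> (int k + 2)) * \<alpha> ^ (k + 2)) sums z}"

end

theory Submission
  imports Defs "HOL-Complex_Analysis.Complex_Analysis"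
begin

text \<open>
  Why the boundary is a circle. The lexicographic condition forbids the digit blocks \<open>111\<close> and
  \<open>1011\<close> (read with increasing index), so a digit sequence is a path in an automaton with
  four states. Eliminating all states but one leaves a single self-similar tile
  \<open>B = \<alpha>B \<union> (\<alpha>\<^sup>2B + 1) \<union> (\<alpha>\<^sup>4B + \<alpha> + \<alpha>\<^sup>2)\<close> and
  \<open>R2 = \<alpha>\<^sup>2 (B \<union> (\<alpha>\<^sup>3B + 1 + \<alpha>))\<close>.

  Computing the intersections of \<open>B\<close> with its neighbours in the tiling generated by this
  equation shows that, apart from single points, they are composed of similar copies of one curve of von
  Koch type, a curve
  \<open>L\<close> made of three copies of itself, scaled by \<open>\<alpha>\<^sup>2\<close>,
  \<open>\<alpha>\<^sup>3\<close>, \<open>\<alpha>\<^sup>4\<close>. Nine copies of \<open>L\<close> close up to the loop \<open>loop_B\<close> around \<open>B\<close>,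
  sixteen to the loop \<open>loop_E\<close> around \<open>B \<union> (\<alpha>\<^sup>3B + 1 + \<alpha>)\<close>. The proof does not
  start from the tile, however, but from these loops, in three steps.

  (1) \<open>L\<close> is an arc and both loops are simple closed curves (\<open>arc_phi\<close>, \<open>loop_simple\<close>). All
  copies involved have the form \<open>q + \<alpha>\<^sup>kL\<close> with \<open>q \<in> \<int>[\<alpha>]\<close>. Two copies are apart
  when discs around them are, which is an integer inequality because squared
  absolute values on \<open>\<int>[\<alpha>]\<close> lie in \<open>\<int>[\<bar>\<alpha>\<bar>\<^sup>2]\<close>; otherwise they are subdivided. Subdivision
  alone would never separate two copies with a common end point, but \<open>L\<close> winds into its end point
  as a logarithmic spiral with ratio \<open>\<alpha>\<^sup>4\<close>, so that there are only finitely many kinds of contact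
  (\<open>contact_holds\<close>). What remains is a finite computation (\<open>curve_checks\<close>, \<open>loop_B_ok\<close>,
  \<open>loop_E_ok\<close>).

  (2) The closed regions bounded by the loops satisfy the two set equations above
  (\<open>region_dissection\<close>). Winding numbers are additive along chains of arcs, and the chain
  \<open>loop_B\<close> minus its three images cancels after seven sides are subdivided; hence a point off
  the curves is inside \<open>loop_B\<close> iff it is inside one of the images, and the curves are nowhere
  dense. The same applies to \<open>loop_E\<close>.

  (3) A nonempty compact solution of the set equations consists of the values of the admissible digit
  sequences (\<open>R2_eq\<close>). So \<open>R2\<close> is \<open>\<alpha>\<^sup>2\<close> times the region bounded by the simple closed curve
  \<open>loop_E\<close>, and its frontier is, by the Jordan curve theorem, \<open>\<alpha>\<^sup>2\<close> times that curve.
\<close>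

section \<open>The lattice \<open>\<int>[\<alpha>]\<close> and its absolute values\<close>

text \<open>The triple \<open>(x, y, z)\<close> stands for \<open>x + y\<alpha> + z\<alpha>\<^sup>2\<close>. Since \<open>\<alpha>\<close> is a unit, division by
\<open>\<alpha>\<close> stays in the lattice. Keeping the points symbolic makes all later checks integer
computations that hold for both non-real roots at once.\<close>

type_synonym lat = "int \<times> int \<times> int"

fun times_root :: "lat \<Rightarrow> lat" where
  "times_root (x, y, z) = (z, x - z, y + 2 * z)"

fun div_root :: "lat \<Rightarrow> lat" where
  "div_root (x, y, z) = (x + y, z - 2 * x, x)"

text \<open>The vector \<open>\<alpha>\<^sup>k(\<alpha> - 1)\<close> between the end points of a copy of the curve at scale \<open>\<alpha>\<^sup>k\<close>.\<close>

abbreviation chord :: "nat \<Rightarrow> lat" where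
  "chord k \<equiv> (times_root ^^ k) (-1, 1, 0)"

locale cubic_root =
  fixes \<alpha> :: complex
  assumes root: "\<alpha> ^ 3 - 2 * \<alpha> ^ 2 + \<alpha> - 1 = 0" and nonreal: "\<alpha> \<notin> \<real>"
begin

definition ev :: "lat \<Rightarrow> complex" where
  "ev p = (case p of (x, y, z) \<Rightarrow> of_int x + of_int y * \<alpha> + of_int z * \<alpha>\<^sup>2)"

definition b :: real where "b = (cmod \<alpha>)\<^sup>2"

lemma alpha_cube: "\<alpha> ^ 3 = 2 * \<alpha> ^ 2 - \<alpha> + 1"
  using root by (simp add: algebra_simps)

lemma alpha_nz [simp]: "\<alpha> \<noteq> 0"
  using nonreal by auto

lemma ev_add [simp]: "ev (p + q) = ev p + ev q"
  by (cases p; cases q) (simp add: ev_def algebra_simps)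

lemma ev_diff [simp]: "ev (p - q) = ev p - ev q"
  by (cases p; cases q) (simp add: ev_def algebra_simps)

lemma ev_times_root [simp]: "ev (times_root p) = \<alpha> * ev p"
proof (cases p)
  case (fields x y z)
  have "\<alpha> * (of_int z * \<alpha>\<^sup>2) = of_int z * (2 * \<alpha> ^ 2 - \<alpha> + 1)"
    unfolding alpha_cube[symmetric] by (simp add: power_numeral_reduce)
  then show ?thesis
    by (simp add: ev_def fields algebra_simps power2_eq_square)
qed

lemma ev_times_root_pow [simp]: "ev ((times_root ^^ k) p) = \<alpha> ^ k * ev p"
  by (induction k) (auto simp: algebra_simps)

lemma ev_div_root [simp]: "ev (div_root p) = ev p / \<alpha>"
proof -
  have "times_root (div_root p) = p"
    by (cases p) auto
  then have "\<alpha> * ev (div_root p) = ev p"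
    by (metis ev_times_root)
  then show ?thesis
    by (simp add: field_simps)
qed

lemma ev_div_root_pow [simp]: "ev ((div_root ^^ k) p) = ev p / \<alpha> ^ k"
  by (induction k) (auto simp: algebra_simps)

text \<open>The quadratic factor \<open>x\<^sup>2 - sx + b\<close> of the cubic has \<open>s = 2 Re \<alpha>\<close>; comparing coefficients
with the real root \<open>2 - s\<close> gives both equations.\<close>

lemma trace_norm:
  shows "b = (2 * Re \<alpha> - 1)\<^sup>2" and "b * (2 - 2 * Re \<alpha>) = 1"
proof -
  define x y where "x = Re \<alpha>" and "y = Im \<alpha>"
  have y: "y \<noteq> 0"
    using nonreal by (simp add: y_def complex_is_Real_iff)
  have \<alpha>: "\<alpha> = Complex x y" by (simp add: x_def y_def)
  have re: "x^3 - 3*x*y^2 - 2*(x^2-y^2) + x - 1 = 0" and im: "3*x^2*y - y^3 - 4*x*y + y = 0"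
    using root unfolding \<alpha> by (simp_all add: complex_eq_iff power2_eq_square power3_eq_cube algebra_simps)
  have "y * (3*x^2 - y^2 - 4*x + 1) = 0"
    using im by (simp add: algebra_simps power2_eq_square power3_eq_cube)
  then have y2: "y^2 = 3*x^2 - 4*x + 1" using y by simp
  have bb: "b = x^2 + y^2" by (simp add: b_def x_def y_def cmod_power2)
  show "b = (2 * Re \<alpha> - 1)\<^sup>2"
    unfolding bb y2 x_def[symmetric] by (simp add: power2_eq_square algebra_simps)
  show "b * (2 - 2 * Re \<alpha>) = 1"
    using re unfolding bb y2 x_def[symmetric] 
    by (simp add: power2_eq_square power3_eq_cube algebra_simps)
qed

lemma b_cubic: "b ^ 3 = b\<^sup>2 - 2 * b + 1" and Re_alpha: "2 * Re \<alpha> = b - b\<^sup>2"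
proof -
  define s where "s = 2 * Re \<alpha>"
  have 1: "b = (s - 1)\<^sup>2" "b * (2 - s) = 1" using trace_norm by (auto simp: s_def)
  have bs: "b * s = 2 * b - 1" using 1(2) by (simp add: algebra_simps)
  have "b ^ 3 = b\<^sup>2 * (s - 1)\<^sup>2" using 1(1) by (simp add: power3_eq_cube power2_eq_square)
  also have "\<dots> = (b * s - b)\<^sup>2" by (simp add: power2_eq_square algebra_simps)
  also have "\<dots> = (b - 1)\<^sup>2" unfolding bs by simp
  finally show *: "b ^ 3 = b\<^sup>2 - 2 * b + 1" by (simp add: power2_eq_square algebra_simps)
  have b0: "b \<noteq> 0" using 1(2) by auto
  have "b * (b - b\<^sup>2) = b\<^sup>2 - b ^ 3" by (simp add: power2_eq_square power3_eq_cube algebra_simps)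
  also have "\<dots> = b * s" using * bs by simp
  finally show "2 * Re \<alpha> = b - b\<^sup>2" using b0 by (simp add: s_def)
qed

lemma b_pos: "b > 0"
  by (simp add: b_def)

lemma b_bounds: "569840 / 10^6 \<le> b" "b \<le> 569841 / 10^6"
proof -
  (* b is a root of x^3 - x^2 + 2x - 1, and the cofactor of b - x below is positive. *)
  have mono: "(b - x) * (b\<^sup>2 + b * x + x\<^sup>2 - b - x + 2) = - (x ^ 3 - x\<^sup>2 + 2 * x - 1)" for x
    using b_cubic by (simp add: power2_eq_square power3_eq_cube algebra_simps)
  have pos: "b\<^sup>2 + b * x + x\<^sup>2 - b - x + 2 > 0" for x
  proof -
    have "b\<^sup>2 + b * x + x\<^sup>2 - b - x + 2 = (b + x / 2 - 1/2)\<^sup>2 + 3/4 * (x - 1/3)\<^sup>2 + 5/3"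
      by (simp add: power2_eq_square algebra_simps)
    then show ?thesis
      by (smt (verit) zero_le_power2 zero_less_divide_iff mult_nonneg_nonneg)
  qed
  have "(b - 569840 / 10^6) * (b\<^sup>2 + b * (569840 / 10^6) + (569840 / 10^6)\<^sup>2 - b - 569840 / 10^6 + 2) > 0"
    unfolding mono by (simp add: power2_eq_square power3_eq_cube)
  then show "569840 / 10^6 \<le> b"
    using pos[of "569840 / 10^6"] by (simp add: zero_less_mult_iff)
  have "(b - 569841 / 10^6) * (b\<^sup>2 + b * (569841 / 10^6) + (569841 / 10^6)\<^sup>2 - b - 569841 / 10^6 + 2) < 0"
    unfolding mono by (simp add: power2_eq_square power3_eq_cube)
  then show "b \<le> 569841 / 10^6"
    using pos[of "569841 / 10^6"] by (simp add: mult_less_0_iff)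
qed

lemma b2_bounds: "324717 / 10^6 \<le> b\<^sup>2" "b\<^sup>2 \<le> 324719 / 10^6"
proof -
  have "(569840 / 10^6)\<^sup>2 \<le> b\<^sup>2" "b\<^sup>2 \<le> (569841 / 10^6)\<^sup>2"
    using b_bounds b_pos by (intro power_mono; simp)+
  then show "324717 / 10^6 \<le> b\<^sup>2" "b\<^sup>2 \<le> 324719 / 10^6"
    by (simp_all add: power2_eq_square)
qed

text \<open>With \<open>b = \<bar>\<alpha>\<bar>\<^sup>2\<close>, the number \<open>2 Re \<alpha> = b - b\<^sup>2\<close> lies in \<open>\<int>[b]\<close>, and \<open>b\<close> is cubic.
Thus squared absolute values are integer combinations of \<open>1\<close>, \<open>b\<close>, \<open>b\<^sup>2\<close>, and the imaginary
part of \<open>\<alpha>\<close> never has to be approximated.\<close>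

lemma cmod_ev:
  "(cmod (ev (x, y, z)))\<^sup>2 =
     of_int (x*x - x*z - y*z) + of_int (y*y + x*y + x*z + 2*y*z) * b + of_int (z*z - x*y - 2*x*z) * b\<^sup>2"
proof -
  define r i where "r = Re \<alpha>" and "i = Im \<alpha>"
  have bi: "i\<^sup>2 = b - r\<^sup>2"
    by (simp add: b_def cmod_power2 r_def i_def)
  have "(cmod (ev (x, y, z)))\<^sup>2 = (x + y * r + z * (r\<^sup>2 - i\<^sup>2))\<^sup>2 + (y * i + z * (2 * r * i))\<^sup>2"
    unfolding cmod_power2 by (simp add: ev_def r_def i_def power2_eq_square algebra_simps)
  also have "\<dots> = (x + y * r + z * (r\<^sup>2 - i\<^sup>2))\<^sup>2 + (y + z * (2 * r))\<^sup>2 * i\<^sup>2"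
    by (simp add: power2_eq_square algebra_simps)
  also have "\<dots> = (x + y * r + z * (2*r\<^sup>2 - b))\<^sup>2 + (y + z * (2 * r))\<^sup>2 * (b - r\<^sup>2)"
    unfolding bi by simp
  also have "\<dots> = x^2 + b * y^2 + b\<^sup>2 * z^2 + x*y*(2*r) + x*z*((2*r)^2 - 2*b) + y*z*b*(2*r)"
    by (simp add: power2_eq_square algebra_simps)
  also have "\<dots> = x^2 + b * y^2 + b\<^sup>2 * z^2 + x*y*(b - b\<^sup>2) + x*z*((b - b\<^sup>2)^2 - 2*b) + y*z*(b*(b - b\<^sup>2))"
    unfolding r_def Re_alpha by (simp add: mult.assoc)
  also have "b * (b - b\<^sup>2) = 2 * b - 1"
    using b_cubic by (simp add: power2_eq_square power3_eq_cube algebra_simps)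
  also have "(b - b\<^sup>2)^2 = b\<^sup>2 - 2 * b^3 + b * b^3"
    by (simp add: power2_eq_square power3_eq_cube algebra_simps)
  also have "\<dots> = b\<^sup>2 - 2 * b^3 + (b^3 - 2 * b\<^sup>2 + b)"
    by (subst (2) b_cubic) (simp add: power2_eq_square power3_eq_cube algebra_simps)
  also have "\<dots> = - 2 * b\<^sup>2 + 3 * b - 1"
    unfolding b_cubic by simp
  finally show ?thesis
    by (simp add: power2_eq_square algebra_simps)
qed

end

section \<open>The boundary curve as a fixed point of subdivision\<close>

context cubic_root begin

abbreviation \<delta> :: complex where "\<delta> \<equiv> \<alpha> - 1"

text \<open>The generator of the curve. The polygon with vertices \<open>-\<delta>\<close>, \<open>-\<alpha>\<^sup>2\<close>, \<open>-\<alpha>\<^sup>4\<delta>\<close>, \<open>0\<close> has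
sides \<open>-\<alpha>\<^sup>2\<delta>\<close>, \<open>-\<alpha>\<^sup>3\<delta>\<close>, \<open>\<alpha>\<^sup>4\<delta>\<close>, because \<open>\<alpha>\<^sup>4 = 1 + \<alpha>\<^sup>2 + \<alpha>\<^sup>3\<close>; each side is replaced by
a scaled copy of the curve, the first two run backwards. The joint \<open>-\<alpha>\<^sup>2\<close> equals
\<open>-(1 + \<alpha>\<^sup>2)\<delta>\<close>, another form of the cubic equation. The parameter intervals are those of nested
path concatenation, so that winding numbers of the three parts add up at once.\<close>

definition subdivide :: "(real \<Rightarrow> complex) \<Rightarrow> real \<Rightarrow> complex" where
  "subdivide f = reversepath (\<lambda>t. \<alpha>\<^sup>2 * f t - \<delta>) +++
     (reversepath (\<lambda>t. \<alpha> ^ 3 * f t - \<alpha>\<^sup>2) +++ (\<lambda>t. \<alpha> ^ 4 * f t))"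

lemma alpha_four: "\<alpha> ^ 4 = 1 + \<alpha>\<^sup>2 + \<alpha> ^ 3"
proof -
  have "\<alpha> ^ 4 - 1 - \<alpha>\<^sup>2 - \<alpha> ^ 3 = (\<alpha> + 1) * (\<alpha> ^ 3 - 2 * \<alpha>\<^sup>2 + \<alpha> - 1)"
    by (simp add: algebra_simps power_numeral_reduce add_divide_distrib diff_divide_distrib)
  also have "\<dots> = 0" using root by simp
  finally show ?thesis by (simp add: algebra_simps)
qed

lemma chord_eq: "(1 + \<alpha>\<^sup>2) * \<delta> = \<alpha>\<^sup>2"
  using alpha_cube by (simp add: algebra_simps power2_eq_square power3_eq_cube)

lemma joint: "\<alpha> ^ 3 * (1 - \<alpha>) - \<alpha>\<^sup>2 = \<alpha> ^ 4 * (1 - \<alpha>)"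
proof -
  have "\<alpha> ^ 4 * (1 - \<alpha>) - \<alpha> ^ 3 * (1 - \<alpha>) + \<alpha>\<^sup>2 = - (\<alpha>\<^sup>2 * (\<alpha> ^ 3 - 2 * \<alpha>\<^sup>2 + \<alpha> - 1))"
    by (simp add: algebra_simps power_numeral_reduce add_divide_distrib diff_divide_distrib)
  also have "\<dots> = 0" using root by simp
  finally show ?thesis by (simp add: algebra_simps)
qed

lemma path_affine: "path f \<Longrightarrow> path (\<lambda>t. c * f t - (d :: complex))"
  unfolding path_def by (auto intro!: continuous_intros)

lemma subdivide_path:
  assumes "path f" "f 0 = -\<delta>" "f 1 = 0"
  shows "path (subdivide f)" "subdivide f 0 = -\<delta>" "subdivide f 1 = 0"
proof -
  define g h k where "g = reversepath (\<lambda>t. \<alpha>\<^sup>2 * f t - \<delta>)"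
    and "h = reversepath (\<lambda>t. \<alpha> ^ 3 * f t - \<alpha>\<^sup>2)" and "k = (\<lambda>t. \<alpha> ^ 4 * f t)"
  have "path g" "path h" "path k"
    using path_affine[OF assms(1), of "\<alpha>\<^sup>2" \<delta>] path_affine[OF assms(1), of "\<alpha> ^ 3" "\<alpha>\<^sup>2"]
      path_affine[OF assms(1), of "\<alpha> ^ 4" 0] by (simp_all add: g_def h_def k_def)
  moreover have "pathfinish g = pathstart h"
    using chord_eq by (simp add: g_def h_def pathstart_def pathfinish_def assms reversepath_def algebra_simps)
  moreover have "pathfinish h = pathstart k"
    using joint by (simp add: h_def k_def pathstart_def pathfinish_def assms reversepath_def)
  ultimately show "path (subdivide f)"
    unfolding subdivide_def g_def[symmetric] h_def[symmetric] k_def[symmetric]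
    by (intro path_join_imp) auto
  show "subdivide f 0 = -\<delta>" "subdivide f 1 = 0"
    using assms by (auto simp: subdivide_def joinpaths_def reversepath_def)
qed

lemma cmod_alpha_sq: "(cmod \<alpha>)\<^sup>2 = b" by (simp add: b_def)

lemma b_lt_1: "b < 1" using b_bounds by simp

lemma cmod_alpha_lt_1: "cmod \<alpha> < 1"
  using b_lt_1 by (simp add: b_def power_less_one_iff)

lemma cmod_power_le_b: "k \<ge> 2 \<Longrightarrow> cmod \<alpha> ^ k \<le> b"
  unfolding b_def using cmod_alpha_lt_1 by (intro power_decreasing) auto

lemma subdivide_contract:
  assumes M: "\<And>t. t \<in> {0..1} \<Longrightarrow> cmod (f t - g t) \<le> M" and t: "t \<in> {0..1}"
  shows "cmod (subdivide f t - subdivide g t) \<le> b * M"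
proof -
  have M0: "M \<ge> 0" using M[of 0] by (smt (verit) atLeastAtMost_iff norm_ge_zero)
  have *: "cmod (\<alpha> ^ k * f s - \<alpha> ^ k * g s) \<le> b * M" if "s \<in> {0..1}" "k \<ge> 2" for k s
  proof -
    have "cmod (\<alpha> ^ k * f s - \<alpha> ^ k * g s) = cmod \<alpha> ^ k * cmod (f s - g s)"
      by (simp add: norm_mult norm_power flip: right_diff_distrib)
    also have "\<dots> \<le> b * M"
      using M[OF that(1)] cmod_power_le_b[OF that(2)] b_pos by (intro mult_mono) auto
    finally show ?thesis .
  qed
  show ?thesis
    using t unfolding subdivide_def joinpaths_def reversepath_def
    by (auto intro!: *)
qed

definition approx :: "nat \<Rightarrow> real \<Rightarrow> complex" where
  "approx n = (subdivide ^^ n) (linepath (-\<delta>) 0)"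

lemma approx_path: "path (approx n) \<and> approx n 0 = -\<delta> \<and> approx n 1 = 0"
proof (induction n)
  case 0
  then show ?case by (simp add: approx_def linepath_0' linepath_1')
next
  case (Suc n)
  then show ?case using subdivide_path[of "approx n"] by (auto simp: approx_def)
qed

text \<open>Subdivision contracts the supremum distance by \<open>b < 1\<close>, so iterating it from a segment
converges uniformly to a fixed point.\<close>

lemma curve_exists:
  "\<exists>\<phi>. path \<phi> \<and> \<phi> 0 = -\<delta> \<and> \<phi> 1 = 0 \<and> (\<forall>t\<in>{0..1}. \<phi> t = subdivide \<phi> t)"
proof -
  define d where "d n t = approx (Suc n) t - approx n t" for n t
  have "compact ((\<lambda>t. d 0 t) ` {0..1})"
    using approx_path unfolding d_def path_def
    by (intro compact_continuous_image continuous_intros) auto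
  then obtain M where M: "\<And>t. t \<in> {0..1} \<Longrightarrow> cmod (d 0 t) \<le> M"
    by (meson bounded_iff compact_imp_bounded imageI)
  have bound: "cmod (d n t) \<le> M * b ^ n" if "t \<in> {0..1}" for n t
    using that
  proof (induction n arbitrary: t)
    case 0
    then show ?case using M by simp
  next
    case (Suc n)
    have "cmod (subdivide (approx (Suc n)) t - subdivide (approx n) t) \<le> b * (M * b ^ n)"
      using Suc unfolding d_def by (intro subdivide_contract) auto
    then show ?case by (simp add: d_def approx_def mult_ac)
  qed
  define \<phi> where "\<phi> t = approx 0 t + (\<Sum>n. d n t)" for t
  have tel: "approx n t = approx 0 t + (\<Sum>i<n. d i t)" for n t
    unfolding d_def by (simp add: sum_lessThan_telescope[of "\<lambda>i. approx i t"])
  have unif: "uniform_limit {0..1} (\<lambda>n t. \<Sum>i<n. d i t) (\<lambda>t. \<Sum>n. d n t) sequentially"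
  proof (rule Weierstrass_m_test)
    show "summable (\<lambda>n. M * b ^ n)"
      using b_pos b_lt_1 by (intro summable_mult summable_geometric) auto
  qed (use bound in auto)
  have "uniform_limit {0..1} (\<lambda>n t. approx 0 t + (\<Sum>i<n. d i t)) \<phi> sequentially"
    unfolding \<phi>_def by (intro uniform_limit_intros unif)
  then have lim: "uniform_limit {0..1} approx \<phi> sequentially"
    unfolding tel[symmetric] .
  have "path \<phi>"
    unfolding path_def
    by (rule uniform_limit_theorem[OF _ lim]) (use approx_path in \<open>auto simp: path_def\<close>)
  have pt: "(\<lambda>n. approx n t) \<longlonglongrightarrow> \<phi> t" if "t \<in> {0..1}" for t
    using lim that by (rule tendsto_uniform_limitI)
  have "\<phi> 0 = -\<delta>" "\<phi> 1 = 0"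
    using pt[of 0] pt[of 1] approx_path by (auto simp: LIMSEQ_const_iff)
  moreover have "\<phi> t = subdivide \<phi> t" if t: "t \<in> {0..1}" for t
  proof -
    have "(\<lambda>n. subdivide (approx n) t) \<longlonglongrightarrow> subdivide \<phi> t"
      using t unfolding subdivide_def joinpaths_def reversepath_def
      by (auto intro!: tendsto_intros pt)
    moreover have "(\<lambda>n. subdivide (approx n) t) \<longlonglongrightarrow> \<phi> t"
      using LIMSEQ_Suc[OF pt[OF t]] by (simp add: approx_def)
    ultimately show ?thesis by (rule LIMSEQ_unique[symmetric])
  qed
  ultimately show ?thesis using \<open>path \<phi>\<close> by blast
qed

definition \<phi> :: "real \<Rightarrow> complex" where
  "\<phi> = (SOME \<phi>. path \<phi> \<and> \<phi> 0 = -\<delta> \<and> \<phi> 1 = 0 \<and> (\<forall>t\<in>{0..1}. \<phi> t = subdivide \<phi> t))"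

lemma phi: "path \<phi>" "\<phi> 0 = -\<delta>" "\<phi> 1 = 0" "t \<in> {0..1} \<Longrightarrow> \<phi> t = subdivide \<phi> t"
  using someI_ex[OF curve_exists] unfolding \<phi>_def[symmetric] by auto

lemma phi_1:
  assumes "t \<in> {0..1}" shows "\<phi> ((1 - t) / 2) = \<alpha>\<^sup>2 * \<phi> t - \<delta>"
proof -
  define x where "x = (1 - t) / 2"
  have x: "x \<in> {0..1}" "x \<le> 1 / 2" "1 - 2 * x = t"
    using assms by (auto simp: x_def field_simps)
  show ?thesis
    unfolding x_def[symmetric] phi(4)[OF x(1)] subdivide_def joinpaths_def reversepath_def if_P[OF x(2)] x(3) ..
qed

lemma phi_2:
  assumes "t \<in> {0..1}" shows "\<phi> (1 / 2 + (1 - t) / 4) = \<alpha> ^ 3 * \<phi> t - \<alpha>\<^sup>2"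
proof (cases "t = 1")
  case True
  have "\<alpha>\<^sup>2 * (1 - \<alpha>) - \<delta> = - \<alpha>\<^sup>2" using chord_eq by (simp add: algebra_simps)
  then show ?thesis
    using True phi_1[of 0] phi(2,3) by simp
next
  case False
  define x where "x = 1 / 2 + (1 - t) / 4"
  have x: "x \<in> {0..1}" "\<not> x \<le> 1 / 2" "2 * x - 1 \<le> 1 / 2" "1 - 2 * (2 * x - 1) = t"
    using False assms by (auto simp: x_def field_simps)
  show ?thesis
    unfolding x_def[symmetric] phi(4)[OF x(1)] subdivide_def joinpaths_def reversepath_def if_not_P[OF x(2)] if_P[OF x(3)] x(4) ..
qed

lemma phi_3:
  assumes "t \<in> {0..1}" shows "\<phi> (3 / 4 + t / 4) = \<alpha> ^ 4 * \<phi> t"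
proof (cases "t = 0")
  case True
  then show ?thesis
    using phi_2[of 0] phi(2,3) joint by simp
next
  case False
  define x where "x = 3 / 4 + t / 4"
  have x: "x \<in> {0..1}" "\<not> x \<le> 1 / 2" "\<not> 2 * x - 1 \<le> 1 / 2" "2 * (2 * x - 1) - 1 = t"
    using False assms by (auto simp: x_def field_simps)
  show ?thesis
    unfolding x_def[symmetric] phi(4)[OF x(1)] subdivide_def joinpaths_def reversepath_def if_not_P[OF x(2)] if_not_P[OF x(3)] x(4) ..
qed

lemma unit_cases:
  fixes x :: real
  assumes "x \<in> {0..1}"
  obtains t where "t \<in> {0..1}" "x = (1 - t) / 2"
  | t where "t \<in> {0..1}" "x = 1 / 2 + (1 - t) / 4"
  | t where "t \<in> {0..1}" "x = 3 / 4 + t / 4"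
proof -
  consider "x \<le> 1/2" | "1/2 \<le> x" "x \<le> 3/4" | "3/4 \<le> x" by linarith
  then show ?thesis
  proof cases
    case 1 then show ?thesis using assms that(1)[of "1 - 2 * x"] by (auto simp: field_simps)
  next
    case 2 then show ?thesis using assms that(2)[of "3 - 4 * x"] by (auto simp: field_simps)
  next
    case 3 then show ?thesis using assms that(3)[of "4 * x - 3"] by (auto simp: field_simps)
  qed
qed

definition L :: "complex set" where "L = path_image \<phi>"

lemma L_eq: "L = \<phi> ` {0..1}" by (simp add: L_def path_image_def)

lemma L_cases:
  assumes "z \<in> L"
  obtains w where "w \<in> L" "z = \<alpha>\<^sup>2 * w - \<delta>"
  | w where "w \<in> L" "z = \<alpha> ^ 3 * w - \<alpha>\<^sup>2"
  | w where "w \<in> L" "z = \<alpha> ^ 4 * w"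
proof -
  obtain x where x: "x \<in> {0..1}" "z = \<phi> x" using assms unfolding L_eq by auto
  have in_L: "\<phi> t \<in> L" if "t \<in> {0..1}" for t using that by (simp add: L_eq)
  from x(1) show ?thesis
  proof (cases rule: unit_cases)
    case (1 t) then show ?thesis using that(1)[of "\<phi> t"] in_L x(2) phi_1 by metis
  next
    case (2 t) then show ?thesis using that(2)[of "\<phi> t"] in_L x(2) phi_2 by metis
  next
    case (3 t) then show ?thesis using that(3)[of "\<phi> t"] in_L x(2) phi_3 by metis
  qed
qed

lemma L_sub:
  assumes "w \<in> L"
  shows "\<alpha>\<^sup>2 * w - \<delta> \<in> L" "\<alpha> ^ 3 * w - \<alpha>\<^sup>2 \<in> L" "\<alpha> ^ 4 * w \<in> L"
proof -
  obtain t where t: "t \<in> {0..1}" "w = \<phi> t" using assms unfolding L_eq by auto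
  have "(1 - t) / 2 \<in> {0..1}" "1 / 2 + (1 - t) / 4 \<in> {0..1}" "3 / 4 + t / 4 \<in> {0..1}"
    using t by (auto simp: field_simps)
  then show "\<alpha>\<^sup>2 * w - \<delta> \<in> L" "\<alpha> ^ 3 * w - \<alpha>\<^sup>2 \<in> L" "\<alpha> ^ 4 * w \<in> L"
    unfolding L_eq t(2) phi_1[OF t(1), symmetric] phi_2[OF t(1), symmetric] phi_3[OF t(1), symmetric]
    by (blast intro: imageI)+
qed

lemma cmod_alpha_le: "cmod \<alpha> \<le> 7549 / 10000"
proof (rule power2_le_imp_le)
  show "(cmod \<alpha>)\<^sup>2 \<le> (7549 / 10000)\<^sup>2"
    using b_bounds by (simp add: cmod_alpha_sq power_divide)
qed simp

text \<open>Let \<open>M\<close> be the largest distance of the curve from the midpoint \<open>-\<delta>/2\<close> of its chord. A point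
where it is attained lies on one of the three parts, and in each case self-similarity gives
\<open>2M \<le> 2bM + b\<close>, that is, \<open>M \<le> b / (2 (1 - b)) = 0.66235...\<close>.\<close>

lemma L_disc:
  assumes "z \<in> L" shows "cmod (z + \<delta> / 2) \<le> 6624 / 10000"
proof -
  have "compact L" unfolding L_def using phi(1) by (rule compact_path_image)
  moreover have "L \<noteq> {}" unfolding L_def by simp
  ultimately obtain m where m: "m \<in> L" and max: "\<And>z. z \<in> L \<Longrightarrow> cmod (z + \<delta> / 2) \<le> cmod (m + \<delta> / 2)"
  proof -
    have "continuous_on L (\<lambda>z. cmod (z + \<delta> / 2))" by (intro continuous_intros)
    from continuous_attains_sup[OF \<open>compact L\<close> \<open>L \<noteq> {}\<close> this] show ?thesis using that by blast
  qed
  define M where "M = cmod (m + \<delta> / 2)"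
  have M0: "M \<ge> 0" by (simp add: M_def)
  have *: "cmod (2 * (\<alpha> ^ k * (w + \<delta> / 2)) + e) \<le> 2 * cmod \<alpha> ^ k * M + cmod e" if "w \<in> L" for k w e
  proof -
    have "cmod (2 * (\<alpha> ^ k * (w + \<delta> / 2)) + e) \<le> 2 * cmod \<alpha> ^ k * cmod (w + \<delta> / 2) + cmod e"
      by (rule order_trans[OF norm_triangle_ineq]) (simp add: norm_mult norm_power)
    also have "\<dots> \<le> 2 * cmod \<alpha> ^ k * M + cmod e"
      using max[OF that] by (intro add_right_mono mult_left_mono) (auto simp: M_def)
    finally show ?thesis .
  qed
  have pw: "cmod \<alpha> ^ k * M \<le> b * M" if "k \<ge> 2" for k
    using cmod_power_le_b[OF that] M0 by (intro mult_right_mono)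
  have twice: "2 * M = cmod (2 * (m + \<delta> / 2))"
    by (simp add: M_def norm_mult del: distrib_left_numeral)
  have by_root: "x = y" if "x - y = c * (\<alpha> ^ 3 - 2 * \<alpha>\<^sup>2 + \<alpha> - 1)" for x y c
    using that root by simp
  have "2 * M \<le> 2 * b * M + b"
    using m
  proof (cases rule: L_cases)
    case (1 w)
    have "2 * M = cmod (2 * (\<alpha> ^ 2 * (w + \<delta> / 2)) + (- \<alpha>\<^sup>2))"
      unfolding twice 1(2) by (rule arg_cong[of _ _ cmod], rule by_root[of _ _ "-1"]) (simp add: algebra_simps power_numeral_reduce add_divide_distrib diff_divide_distrib)
    then show ?thesis
      using *[OF 1(1), of 2 "- \<alpha>\<^sup>2"] pw[of 2] by (simp add: norm_power cmod_alpha_sq)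
  next
    case (2 w)
    have "2 * M = cmod (2 * (\<alpha> ^ 3 * (w + \<delta> / 2)) + (- (\<alpha> ^ 4)))"
      unfolding twice 2(2) by (rule arg_cong[of _ _ cmod], rule by_root[of _ _ "1"]) (simp add: algebra_simps power_numeral_reduce add_divide_distrib diff_divide_distrib)
    then show ?thesis
      using *[OF 2(1), of 3 "- (\<alpha> ^ 4)"] pw[of 3] cmod_power_le_b[of 4] by (simp add: norm_power)
  next
    case (3 w)
    have "2 * M = cmod (2 * (\<alpha> ^ 4 * (w + \<delta> / 2)) + (1 - \<alpha>\<^sup>2) * \<alpha>\<^sup>2)"
      unfolding twice 3(2) by (rule arg_cong[of _ _ cmod], rule by_root[of _ _ "1 - \<alpha>\<^sup>2"]) (simp add: algebra_simps power_numeral_reduce add_divide_distrib diff_divide_distrib)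
    moreover have "cmod ((1 - \<alpha>\<^sup>2) * \<alpha>\<^sup>2) \<le> (1 + b) * b"
      using norm_triangle_ineq4[of 1 "\<alpha>\<^sup>2"]
      by (simp add: norm_mult norm_power cmod_alpha_sq b_pos)
    moreover have "cmod \<alpha> ^ 4 = b * b"
      by (simp add: b_def power2_eq_square power_numeral_reduce)
    ultimately have "2 * M \<le> 2 * (b * b) * M + (1 + b) * b"
      using *[OF 3(1), of 4 "(1 - \<alpha>\<^sup>2) * \<alpha>\<^sup>2"] by simp
    then have "(1 + b) * (2 * M) \<le> (1 + b) * (2 * b * M + b)"
      by (simp add: algebra_simps)
    then show ?thesis
      using b_pos by simp
  qed
  then have "2 * (1 - b) * M \<le> b" by (simp add: algebra_simps)
  moreover have "2 * (1 - 569841 / 10^6) * M \<le> 2 * (1 - b) * M"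
    using b_bounds M0 by (intro mult_right_mono) auto
  ultimately have "M \<le> 6624 / 10000" using b_bounds by simp
  then show ?thesis using max[OF assms] by (simp add: M_def)
qed

end

section \<open>Deciding how copies of the curve meet\<close>

text \<open>The pair \<open>(q, k)\<close> encodes the copy \<open>q + \<alpha>\<^sup>kL\<close>, which runs from \<open>q - \<alpha>\<^sup>k\<delta>\<close> to \<open>q\<close>. No
rotations other than powers of \<open>\<alpha>\<close> occur.\<close>

type_synonym piece = "lat \<times> nat"

definition pieces :: "piece \<Rightarrow> piece list" where
  "pieces A = (case A of (q, k) \<Rightarrow>
     [(q - chord k, k + 2), (q - (times_root ^^ (k + 2)) (1, 0, 0), k + 3), (q, k + 4)])"

text \<open>A sufficient test for disjointness. After division by the smaller power of \<open>\<alpha>\<close>, the doubled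
distance of the two disc centres is compared with \<open>2 * 0.6624 * (1 + \<bar>\<alpha>\<bar>\<^sup>j)\<close>. The table contains
upper bounds for \<open>10\<^sup>6\<close> times the squares of these radii, and \<open>b\<close>, \<open>b\<^sup>2\<close> are enclosed with
six decimals. Pairs of very different size (\<open>j \<ge> 6\<close>) are not decided.\<close>

definition apart :: "piece \<Rightarrow> piece \<Rightarrow> bool" where
  "apart A B = (case A of (p, k) \<Rightarrow> case B of (q, l) \<Rightarrow>
     let m = min k l; j = max k l - m in
     case (div_root ^^ m) (p + p - chord k - (q + q - chord l)) of (x, y, z) \<Rightarrow>
     let u = y*y + x*y + x*z + 2*y*z; v = z*z - x*y - 2*x*z in
     j < 6 \<and> 1000000 * (x*x - x*z - y*z) + min (569840 * u) (569841 * u) + min (324717 * v) (324719 * v)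
       > [7020381, 5405161, 4325569, 3590647, 3080025, 2721511] ! j)"

text \<open>Tests that two copies meet at most in the listed points, subdividing the larger one up to the
given depth. Two copies with the same end point \<open>q\<close> are accepted without subdivision if \<open>q\<close> is listed
and their scales differ modulo 4; this is justified by \<open>contact_holds\<close>.\<close>

fun meet_only :: "nat \<Rightarrow> piece \<Rightarrow> piece \<Rightarrow> lat list \<Rightarrow> bool" where
  "meet_only 0 A B ws \<longleftrightarrow>
     apart A B \<or> fst A = fst B \<and> fst A \<in> set ws \<and> snd A mod 4 \<noteq> snd B mod 4"
| "meet_only (Suc n) A B ws \<longleftrightarrow>
     apart A B \<or> fst A = fst B \<and> fst A \<in> set ws \<and> snd A mod 4 \<noteq> snd B mod 4 \<or>
     (if snd A \<le> snd B then list_all (\<lambda>X. meet_only n X B ws) (pieces A)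
      else list_all (\<lambda>X. meet_only n A X ws) (pieces B))"

context cubic_root begin

definition arc_set :: "piece \<Rightarrow> complex set" where
  "arc_set A = (\<lambda>w. ev (fst A) + \<alpha> ^ snd A * w) ` L"

lemma ev_delta [simp]: "ev (-1, 1, 0) = \<delta>"
  by (simp add: ev_def)

lemma ev_one [simp]: "ev (1, 0, 0) = 1"
  by (simp add: ev_def)

lemma arc_set_pieces: "arc_set A = (\<Union>X\<in>set (pieces A). arc_set X)"
proof (cases A)
  case (Pair q k)
  show ?thesis
  proof (intro equalityI subsetI)
    fix z assume "z \<in> arc_set A"
    then obtain w where w: "w \<in> L" "z = ev q + \<alpha> ^ k * w" by (auto simp: arc_set_def Pair)
    from w(1) show "z \<in> (\<Union>X\<in>set (pieces A). arc_set X)"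
    proof (cases rule: L_cases)
      case (1 v)
      have "z \<in> arc_set (q - chord k, k + 2)"
        using 1(1) unfolding arc_set_def by (intro image_eqI[of _ _ v]) (simp_all add: w(2) 1(2) power_add power2_eq_square algebra_simps)
      then show ?thesis by (simp add: pieces_def Pair)
    next
      case (2 v)
      have "z \<in> arc_set (q - (times_root ^^ (k + 2)) (1, 0, 0), k + 3)"
        using 2(1) unfolding arc_set_def by (intro image_eqI[of _ _ v]) (simp_all add: w(2) 2(2) power_add power2_eq_square algebra_simps)
      then show ?thesis by (simp add: pieces_def Pair)
    next
      case (3 v)
      then have "z \<in> arc_set (q, k + 4)"
        by (auto simp: arc_set_def w(2) image_iff power_add intro!: bexI[of _ v])
      then show ?thesis by (simp add: pieces_def Pair)
    qed
  next
    fix z assume "z \<in> (\<Union>X\<in>set (pieces A). arc_set X)"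
    then consider w where "w \<in> L" "z = ev (q - chord k) + \<alpha> ^ (k + 2) * w"
      | w where "w \<in> L" "z = ev (q - (times_root ^^ (k + 2)) (1, 0, 0)) + \<alpha> ^ (k + 3) * w"
      | w where "w \<in> L" "z = ev q + \<alpha> ^ (k + 4) * w"
      by (auto simp: pieces_def Pair arc_set_def simp del: ev_diff)
    then show "z \<in> arc_set A"
    proof cases
      case 1
      then have "z = ev q + \<alpha> ^ k * (\<alpha>\<^sup>2 * w - \<delta>)"
        by (simp add: power_add power2_eq_square algebra_simps)
      then show ?thesis using L_sub(1)[OF 1(1)] by (simp add: arc_set_def Pair)
    next
      case 2
      then have "z = ev q + \<alpha> ^ k * (\<alpha> ^ 3 * w - \<alpha>\<^sup>2)"
        by (simp add: power_add power2_eq_square algebra_simps)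
      then show ?thesis using L_sub(2)[OF 2(1)] by (simp add: arc_set_def Pair)
    next
      case 3
      then have "z = ev q + \<alpha> ^ k * (\<alpha> ^ 4 * w)"
        by (simp add: power_add algebra_simps)
      then show ?thesis using L_sub(3)[OF 3(1)] by (simp add: arc_set_def Pair)
    qed
  qed
qed

lemma radius_table:
  assumes "j < 6"
  shows "1000000 * (2 * (6624 / 10000) * (1 + cmod \<alpha> ^ j))\<^sup>2
    \<le> of_int ([7020381, 5405161, 4325569, 3590647, 3080025, 2721511] ! j)"
proof -
  have p2: "cmod \<alpha> ^ 2 \<le> 569841 / 10^6" using b_bounds by (simp add: cmod_alpha_sq)
  have p3: "cmod \<alpha> ^ 3 \<le> 4303 / 10000"
    using mult_mono[OF p2 cmod_alpha_le] by (simp add: power3_eq_cube power2_eq_square)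
  have p4: "cmod \<alpha> ^ 4 \<le> 324719 / 10^6"
    using b2_bounds by (simp add: b_def)
  have p5: "cmod \<alpha> ^ 5 \<le> 2452 / 10000"
    using mult_mono[OF p4 cmod_alpha_le] by (simp add: power_numeral_reduce mult_ac)
  have *: "1000000 * (2 * (6624 / 10000) * (1 + x))\<^sup>2 \<le> N"
    if "0 \<le> x" "x \<le> c" "1000000 * (2 * (6624 / 10000) * (1 + c))\<^sup>2 \<le> N" for x c N :: real
    by (rule order_trans[OF _ that(3)]) (use that in \<open>intro mult_left_mono power_mono; simp\<close>)
  consider "j = 0" | "j = 1" | "j = 2" | "j = 3" | "j = 4" | "j = 5" using assms by linarith
  then show ?thesis
  proof cases
    case 1 then show ?thesis by (simp add: power2_eq_square)
  next
    case 2 then show ?thesis using *[OF _ cmod_alpha_le, of 5405161] by (simp add: power2_eq_square)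
  next
    case 3 then show ?thesis using *[OF _ p2, of 4325569] by (simp add: power2_eq_square)
  next
    case 4 then show ?thesis using *[OF _ p3, of 3590647] by (simp add: power2_eq_square)
  next
    case 5 then show ?thesis using *[OF _ p4, of 3080025] by (simp add: power2_eq_square)
  next
    case 6 then show ?thesis using *[OF _ p5, of 2721511] by (simp add: power2_eq_square)
  qed
qed

lemma min_le_mult: "lo \<le> x \<Longrightarrow> x \<le> hi \<Longrightarrow> min (lo * u) (hi * u) \<le> x * (u::real)"
  by (cases "u \<ge> 0") (auto simp: min_def intro: mult_right_mono mult_right_mono_neg order_trans)

lemma apart_sound:
  assumes "apart A B" shows "arc_set A \<inter> arc_set B = {}"
proof (rule ccontr)
  assume "arc_set A \<inter> arc_set B \<noteq> {}"
  obtain p k q l where A: "A = (p, k)" and B: "B = (q, l)" by (cases A, cases B)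
  define m where "m = min k l"
  define j where "j = max k l - m"
  define t where "t = (div_root ^^ m) (p + p - chord k - (q + q - chord l))"
  obtain x y z where xyz: "t = (x, y, z)" by (cases t)
  from \<open>arc_set A \<inter> arc_set B \<noteq> {}\<close> obtain w v where wv: "w \<in> L" "v \<in> L" "ev p + \<alpha> ^ k * w = ev q + \<alpha> ^ l * v"
    unfolding arc_set_def A B by auto
  (* The discs are centred at the midpoints of the chords; t is twice the difference of the centres,
     divided by the m-th power of \<alpha>, so that no fractions occur. *)
  have "\<alpha> ^ m * ev t = 2 * (ev p - ev q) - \<alpha> ^ k * \<delta> + \<alpha> ^ l * \<delta>"
    by (simp add: t_def ev_delta)
  also have "ev p - ev q = \<alpha> ^ l * v - \<alpha> ^ k * w"
    using wv(3) by (simp add: algebra_simps)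
  also have "2 * (\<alpha> ^ l * v - \<alpha> ^ k * w) - \<alpha> ^ k * \<delta> + \<alpha> ^ l * \<delta> =
      2 * (\<alpha> ^ l * (v + \<delta> / 2)) - 2 * (\<alpha> ^ k * (w + \<delta> / 2))"
    by (simp add: algebra_simps add_divide_distrib diff_divide_distrib)
  also have "cmod \<dots> \<le> cmod (2 * (\<alpha> ^ l * (v + \<delta> / 2))) + cmod (2 * (\<alpha> ^ k * (w + \<delta> / 2)))"
    by (rule norm_triangle_ineq4)
  also have "\<dots> = 2 * (cmod \<alpha> ^ l * cmod (v + \<delta> / 2)) + 2 * (cmod \<alpha> ^ k * cmod (w + \<delta> / 2))"
    by (simp only: norm_mult norm_power) simp
  also have "\<dots> \<le> 2 * (cmod \<alpha> ^ l * (6624 / 10000)) + 2 * (cmod \<alpha> ^ k * (6624 / 10000))"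
    using L_disc[OF wv(1)] L_disc[OF wv(2)] by (intro add_mono mult_left_mono) auto
  also have "\<dots> = cmod \<alpha> ^ m * (2 * (6624 / 10000) * (1 + cmod \<alpha> ^ j))"
  proof -
    have "l = m \<and> k = m + j \<or> k = m \<and> l = m + j"
      by (auto simp: m_def j_def)
    then show ?thesis by (auto simp: power_add algebra_simps)
  qed
  finally have "cmod (ev t) \<le> 2 * (6624 / 10000) * (1 + cmod \<alpha> ^ j)"
    by (simp add: norm_mult norm_power)
  then have "(cmod (ev t))\<^sup>2 \<le> (2 * (6624 / 10000) * (1 + cmod \<alpha> ^ j))\<^sup>2"
    by (rule power_mono) simp
  moreover have ap: "j < 6" and
    gt: "1000000 * (x*x - x*z - y*z) + min (569840 * (y*y + x*y + x*z + 2*y*z)) (569841 * (y*y + x*y + x*z + 2*y*z))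
      + min (324717 * (z*z - x*y - 2*x*z)) (324719 * (z*z - x*y - 2*x*z))
       > [7020381, 5405161, 4325569, 3590647, 3080025, 2721511] ! j"
    using assms xyz unfolding apart_def A B t_def j_def m_def by (auto simp: Let_def)
  ultimately have le: "1000000 * (cmod (ev t))\<^sup>2 \<le> of_int ([7020381, 5405161, 4325569, 3590647, 3080025, 2721511] ! j)"
    using radius_table[OF ap] by linarith
  define P U V where "P = x*x - x*z - y*z" and "U = y*y + x*y + x*z + 2*y*z" and "V = z*z - x*y - 2*x*z"
  have "real_of_int ([7020381, 5405161, 4325569, 3590647, 3080025, 2721511] ! j)
     < real_of_int (1000000 * P + min (569840 * U) (569841 * U) + min (324717 * V) (324719 * V))"
    using gt unfolding P_def U_def V_def of_int_less_iff .
  also have "\<dots> = 1000000 * P + min (569840 * real_of_int U) (569841 * real_of_int U) + min (324717 * real_of_int V) (324719 * real_of_int V)"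
    by (simp add: of_int_min)
  also have "\<dots> \<le> 1000000 * P + (10^6 * b) * U + (10^6 * b\<^sup>2) * V"
    using b_bounds b2_bounds by (intro add_mono min_le_mult) auto
  also have "\<dots> = 1000000 * (cmod (ev t))\<^sup>2"
    unfolding xyz cmod_ev P_def U_def V_def by (simp add: algebra_simps)
  finally show False using le by simp
qed

definition contact :: bool where
  "contact \<longleftrightarrow> (\<forall>q k l. k mod 4 \<noteq> l mod 4 \<longrightarrow> arc_set (q, k) \<inter> arc_set (q, l) \<subseteq> {ev q})"

text \<open>With an empty list of permitted points the second clause of the test cannot
apply. This allows the test to be used in the proof of \<open>contact\<close> itself.\<close>

lemma meet_only_sound:
  assumes "meet_only n A B ws" "ws = [] \<or> contact"
  shows "arc_set A \<inter> arc_set B \<subseteq> ev ` set ws"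
  using assms(1)
proof (induction n arbitrary: A B)
  case 0
  then show ?case
    using assms(2) apart_sound[of A B] unfolding contact_def
    by (cases A; cases B) fastforce
next
  case (Suc n)
  consider "apart A B" | "fst A = fst B" "fst A \<in> set ws" "snd A mod 4 \<noteq> snd B mod 4"
    | "list_all (\<lambda>X. meet_only n X B ws) (pieces A)"
    | "list_all (\<lambda>X. meet_only n A X ws) (pieces B)"
    using Suc.prems by (auto split: if_splits)
  then show ?case
  proof cases
    case 1 then show ?thesis using apart_sound by auto
  next
    case 2 then show ?thesis
      using assms(2) unfolding contact_def by (cases A; cases B) fastforce
  next
    case 3
    then have "arc_set X \<inter> arc_set B \<subseteq> ev ` set ws" if "X \<in> set (pieces A)" for X
      using Suc.IH that by (auto simp: list_all_iff)
    then show ?thesis unfolding arc_set_pieces[of A] by blast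
  next
    case 4
    then have "arc_set A \<inter> arc_set X \<subseteq> ev ` set ws" if "X \<in> set (pieces B)" for X
      using Suc.IH that by (auto simp: list_all_iff)
    then show ?thesis unfolding arc_set_pieces[of B] by blast
  qed
qed

lemma spiral_checks:
  "list_all (\<lambda>m. list_all (\<lambda>X. meet_only 2 X (0, m) []) (take 2 (pieces (0, 0))) \<and>
                 (m = 3 \<or> list_all (\<lambda>X. meet_only 2 (0, 4) X []) (take 2 (pieces (0, m))))) [1, 2, 3]"
  by code_simp

lemma arc_set_scale: "arc_set (0, k + l) = (\<lambda>w. \<alpha> ^ k * w) ` arc_set (0, l)"
  by (auto simp: arc_set_def image_iff power_add zero_prod_def ev_def)

text \<open>Near its end point \<open>0\<close>, \<open>L\<close> looks like \<open>\<alpha>\<^sup>4L\<close>. For \<open>m = 1, 2\<close>, the computation shows that the only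
parts through which \<open>L\<close> and \<open>\<alpha>\<^sup>mL\<close> can meet are \<open>\<alpha>\<^sup>4L\<close> and \<open>\<alpha>\<^sup>m\<^sup>+\<^sup>4L\<close>; so \<open>L \<inter> \<alpha>\<^sup>mL\<close> is contained in
\<open>\<alpha>\<^sup>4(L \<inter> \<alpha>\<^sup>mL)\<close> and hence in \<open>{0}\<close>. The case \<open>m = 3\<close> reduces to \<open>m = 1\<close>, as
\<open>\<alpha>\<^sup>4L \<inter> \<alpha>\<^sup>3L = \<alpha>\<^sup>3(\<alpha>L \<inter> L)\<close>, and exponents matter only modulo 4 because \<open>\<alpha>\<^sup>4L \<subseteq> L\<close>.\<close>

lemma contact_holds: contact
proof -
  have ev0: "ev 0 = 0" by (simp add: ev_def zero_prod_def)
  have arc0: "arc_set (0, k) = (\<lambda>w. \<alpha> ^ k * w) ` L" for k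
    by (simp add: arc_set_def ev0)
  have split: "arc_set (0, k) = (\<Union>X\<in>set (take 2 (pieces (0, k))). arc_set X) \<union> arc_set (0, k + 4)" for k
    unfolding arc_set_pieces[of "(0, k)"] by (auto simp: pieces_def numeral_2_eq_2)
  have disj: "arc_set (0, 0) \<inter> arc_set (0, m) \<subseteq> arc_set (0, 4)" if "m \<in> {1, 2, 3}" for m
  proof -
    have "meet_only 2 X (0, m) []" if "X \<in> set (take 2 (pieces (0, 0)))" for X
      using spiral_checks \<open>m \<in> {1, 2, 3}\<close> that by (auto simp: list_all_iff)
    then have "arc_set X \<inter> arc_set (0, m) = {}" if "X \<in> set (take 2 (pieces (0, 0)))" for X
      using meet_only_sound[of 2 X "(0, m)" "[]"] that by auto
    then have "(\<Union>X\<in>set (take 2 (pieces (0, 0))). arc_set X) \<inter> arc_set (0, m) = {}" by blast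
    then show ?thesis using split[of 0] by auto
  qed
  have disj2: "arc_set (0, 4) \<inter> arc_set (0, m) \<subseteq> arc_set (0, m + 4)" if "m \<in> {1, 2}" for m
  proof -
    have "meet_only 2 (0, 4) X []" if "X \<in> set (take 2 (pieces (0, m)))" for X
      using spiral_checks \<open>m \<in> {1, 2}\<close> that by (auto simp: list_all_iff)
    then have "arc_set (0, 4) \<inter> arc_set X = {}" if "X \<in> set (take 2 (pieces (0, m)))" for X
      using meet_only_sound[of 2 "(0, 4)" X "[]"] that by auto
    then have "arc_set (0, 4) \<inter> (\<Union>X\<in>set (take 2 (pieces (0, m))). arc_set X) = {}" by blast
    then show ?thesis using split[of m] by auto
  qed
  have step: "\<exists>y. y \<in> arc_set (0, 0) \<inter> arc_set (0, m) \<and> x = \<alpha> ^ 4 * y"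
    if "m \<in> {1, 2}" "x \<in> arc_set (0, 0) \<inter> arc_set (0, m)" for m x
  proof -
    have "x \<in> arc_set (0, 4 + 0)" "x \<in> arc_set (0, 4 + m)"
      using disj[of m] disj2[of m] that by (auto simp: add.commute)
    then show ?thesis unfolding arc_set_scale[of 4] by auto
  qed
  have iter: "\<exists>y. y \<in> arc_set (0, 0) \<inter> arc_set (0, m) \<and> x = \<alpha> ^ (4 * n) * y"
    if "m \<in> {1, 2}" "x \<in> arc_set (0, 0) \<inter> arc_set (0, m)" for m x n
  proof (induction n)
    case (Suc n)
    then obtain y where "y \<in> arc_set (0, 0) \<inter> arc_set (0, m)" "x = \<alpha> ^ (4 * n) * y" by blast
    moreover from step[OF that(1) this(1)] obtain z
      where "z \<in> arc_set (0, 0) \<inter> arc_set (0, m)" "y = \<alpha> ^ 4 * z" by blast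
    ultimately show ?case by (auto simp: power_add mult_ac intro!: exI[of _ z])
  qed (use that in auto)
  have base12: "arc_set (0, 0) \<inter> arc_set (0, m) \<subseteq> {0}" if m: "m \<in> {1, 2}" for m
  proof
    fix x assume x: "x \<in> arc_set (0, 0) \<inter> arc_set (0, m)"
    have "compact L" unfolding L_def using phi(1) by (rule compact_path_image)
    then obtain C where C: "\<And>w. w \<in> L \<Longrightarrow> cmod w \<le> C"
      by (meson bounded_iff compact_imp_bounded)
    have "cmod x \<le> C * (cmod \<alpha> ^ 4) ^ n" for n
    proof -
      from iter[OF m x, of n] obtain y where "y \<in> L" "x = \<alpha> ^ (4 * n) * y"
        by (auto simp: arc0)
      then have "cmod x = cmod y * (cmod \<alpha> ^ 4) ^ n"
        by (simp add: norm_mult norm_power flip: power_mult)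
      then show ?thesis using C[OF \<open>y \<in> L\<close>] by (simp add: mult_right_mono)
    qed
    moreover have "(\<lambda>n. C * (cmod \<alpha> ^ 4) ^ n) \<longlonglongrightarrow> C * 0"
      using cmod_alpha_lt_1 by (intro tendsto_mult tendsto_const LIMSEQ_power_zero) (auto simp: power_less_one_iff)
    ultimately have "cmod x \<le> C * 0"
      by (intro LIMSEQ_le_const[of _ "C * 0"]) auto
    then show "x \<in> {0}" by simp
  qed
  have base: "arc_set (0, 0) \<inter> arc_set (0, m) \<subseteq> {0}" if m: "m \<in> {1, 2, 3}" for m
  proof (cases "m = 3")
    case True
    have "arc_set (0, 0) \<inter> arc_set (0, 3) \<subseteq> arc_set (0, 3 + 1) \<inter> arc_set (0, 3 + 0)"
      using disj[of 3] by auto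
    also have "\<dots> = (\<lambda>w. \<alpha> ^ 3 * w) ` (arc_set (0, 1) \<inter> arc_set (0, 0))"
      unfolding arc_set_scale[of 3] by (subst image_Int) (auto simp: inj_on_def)
    also have "\<dots> \<subseteq> {0}" using base12[of 1] by auto
    finally show ?thesis using True by simp
  qed (use base12 m in auto)
  have shrink: "arc_set (0, 4 * j + m) \<subseteq> arc_set (0, m)" for j m
  proof (induction j)
    case (Suc j)
    then show ?case using split[of "4 * j + m"] by (auto simp: algebra_simps)
  qed simp
  have less: "arc_set (0, k) \<inter> arc_set (0, l) \<subseteq> {0}" if "k < l" "k mod 4 \<noteq> l mod 4" for k l
  proof -
    define m j where "m = (l - k) mod 4" and "j = (l - k) div 4"
    have l: "l = k + (4 * j + m)" using that(1) by (simp add: m_def j_def)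
    have "m \<noteq> 0"
    proof
      assume "m = 0"
      then have "l mod 4 = k mod 4" using l by simp
      with that(2) show False by simp
    qed
    moreover have "m < 4" by (simp add: m_def)
    ultimately have m: "m \<in> {1, 2, 3}" by auto
    have "arc_set (0, k) \<inter> arc_set (0, l) = (\<lambda>w. \<alpha> ^ k * w) ` (arc_set (0, 0) \<inter> arc_set (0, 4 * j + m))"
      using arc_set_scale[of k 0] arc_set_scale[of k "4 * j + m"] unfolding l
      by (subst image_Int) (auto simp: inj_on_def)
    also have "\<dots> \<subseteq> {0}" using base[OF m] shrink[of j m] by auto
    finally show ?thesis .
  qed
  have trans: "arc_set (q, k) = (\<lambda>w. ev q + w) ` arc_set (0, k)" for q k
    by (simp add: arc_set_def image_image ev0)
  show ?thesis
    unfolding contact_def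
  proof (intro allI impI)
    fix q k l assume "k mod 4 \<noteq> (l :: nat) mod 4"
    then have "arc_set (0, k) \<inter> arc_set (0, l) \<subseteq> {0}"
      using less[of k l] less[of l k] by (cases k l rule: linorder_cases) auto
    then show "arc_set (q, k) \<inter> arc_set (q, l) \<subseteq> {ev q}"
      unfolding trans[of q] by auto
  qed
qed

lemma copies_meet_only: "meet_only n A B ws \<Longrightarrow> arc_set A \<inter> arc_set B \<subseteq> ev ` set ws"
  using meet_only_sound contact_holds by blast

end

section \<open>The curve is an arc, and the two loops\<close>

text \<open>A copy of the curve with a direction: \<open>False\<close> means that it is run backwards.\<close>

type_synonym step = "bool \<times> piece"

fun step_start :: "step \<Rightarrow> lat" where
  "step_start (s, q, k) = (if s then q - chord k else q)"

fun step_end :: "step \<Rightarrow> lat" where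
  "step_end (s, q, k) = (if s then q else q - chord k)"

fun linked :: "step list \<Rightarrow> bool" where
  "linked (x # y # xs) \<longleftrightarrow> step_end x = step_start y \<and> linked (y # xs)"
| "linked _ \<longleftrightarrow> True"

text \<open>Depth 3 of subdivision suffices for all pairs that occur.\<close>

fun chain_ok :: "step list \<Rightarrow> bool" where
  "chain_ok (x # y # xs) \<longleftrightarrow> meet_only 3 (snd x) (snd y) [step_end x] \<and>
     list_all (\<lambda>z. meet_only 3 (snd x) (snd z) []) xs \<and> chain_ok (y # xs)"
| "chain_ok _ \<longleftrightarrow> True"

definition loop_ok :: "step list \<Rightarrow> bool" where
  "loop_ok xs \<longleftrightarrow> (case xs of x # y # z # zs \<Rightarrow>
     linked xs \<and> chain_ok (y # z # zs) \<and> step_end (last xs) = step_start x \<and>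
     meet_only 3 (snd x) (snd y) [step_end x] \<and>
     meet_only 3 (snd x) (snd (last xs)) [step_start x] \<and>
     list_all (\<lambda>v. meet_only 3 (snd x) (snd v) []) (butlast (z # zs)) | _ \<Rightarrow> False)"

text \<open>The three parts of \<open>L\<close> meet as in a polygon: the first and second only in \<open>-\<alpha>\<^sup>2\<close>, the second
and third only in \<open>-1 - 2\<alpha>\<^sup>2 = -\<alpha>\<^sup>4\<delta>\<close>, and the first and third not at all.\<close>

lemma curve_checks:
  "meet_only 2 ((1, -1, 0), 2) ((0, 0, -1), 3) [(0, 0, -1)]"
  "meet_only 2 ((0, 0, -1), 3) ((0, 0, 0), 4) [(-1, 0, -2)]"
  "meet_only 0 ((1, -1, 0), 2) ((0, 0, 0), 4) []"
  by code_simp+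

text \<open>The sides of the tile \<open>B\<close> in cyclic order: they are its intersections with its neighbours in a
tiling, cut into copies of \<open>L\<close>.\<close>

definition loop_B :: "step list" where
  "loop_B = [(True, (-1, 2, -1), 0), (False, (-1, 2, -1), 3), (True, (-1, 1, -1), 2),
     (True, (-1, 0, 0), 1), (False, (-1, 0, 0), 0), (False, (0, -1, 0), 1),
     (True, (1, -1, 0), 2), (False, (1, -1, 0), 1), (True, (0, 1, -1), 0)]"

text \<open>The tiles \<open>B\<close> and \<open>\<alpha>\<^sup>3B + 1 + \<alpha>\<close> share the second and third part of the last side of
\<open>loop_B\<close>. Removing these from the two loops leaves eight sides and one part of a side of the
first tile, followed by seven sides of the second.\<close>

definition loop_E :: "step list" where
  "loop_E = [(True, (-1, 2, -1), 0), (False, (-1, 2, -1), 3), (True, (-1, 1, -1), 2),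
     (True, (-1, 0, 0), 1), (False, (-1, 0, 0), 0), (False, (0, -1, 0), 1),
     (True, (1, -1, 0), 2), (False, (1, -1, 0), 1),
     (False, (1, 0, -1), 2), (True, (1, 1, -1), 3), (False, (1, 1, -1), 6), (True, (-1, 2, -4), 5),
     (True, (0, 2, -2), 4), (False, (0, 2, -2), 3), (False, (-1, 2, -3), 4), (True, (0, 1, -1), 5)]"

lemma loop_B_ok: "loop_ok loop_B"
  by code_simp

lemma loop_E_ok: "loop_ok loop_E"
  by code_simp

fun refine :: "piece list \<Rightarrow> step \<Rightarrow> step list" where
  "refine P (s, A) = (if A \<in> set P then
     (case pieces A of [X, Y, Z] \<Rightarrow>
       if s then [(False, X), (False, Y), (True, Z)] else [(False, Z), (True, Y), (True, X)])
     else [(s, A)])"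

fun flip :: "step \<Rightarrow> step" where "flip (s, A) = (\<not> s, A)"

text \<open>Whether a list of directed copies vanishes as a formal sum.\<close>

function cancels :: "step list \<Rightarrow> bool" where
  "cancels [] \<longleftrightarrow> True"
| "cancels (x # xs) \<longleftrightarrow> flip x \<in> set xs \<and> cancels (remove1 (flip x) xs)"
  by pat_completeness auto
termination
  by (relation "measures [length]") (auto simp: length_remove1)

fun shift :: "nat \<Rightarrow> lat \<Rightarrow> step \<Rightarrow> step" where
  "shift e t (s, q, k) = (s, (times_root ^^ e) q + t, k + e)"

definition refine_all :: "piece list \<Rightarrow> step list \<Rightarrow> step list" where
  "refine_all P xs = concat (map (refine P) xs)"

context cubic_root begin

lemma phi_in_L: "t \<in> {0..1} \<Longrightarrow> \<phi> t \<in> L" by (simp add: L_eq)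

lemma meet_12:
  assumes "s \<in> {0..1}" "t \<in> {0..1}" "\<alpha>\<^sup>2 * \<phi> s - \<delta> = \<alpha> ^ 3 * \<phi> t - \<alpha>\<^sup>2"
  shows "\<alpha>\<^sup>2 * \<phi> s - \<delta> = - \<alpha>\<^sup>2"
proof -
  have "\<alpha>\<^sup>2 * \<phi> s - \<delta> \<in> arc_set ((1, -1, 0), 2)"
    unfolding arc_set_def using assms(1) by (intro image_eqI[of _ _ "\<phi> s"]) (simp_all add: phi_in_L ev_def)
  moreover have "\<alpha>\<^sup>2 * \<phi> s - \<delta> \<in> arc_set ((0, 0, -1), 3)"
    unfolding arc_set_def assms(3) using assms(2) by (intro image_eqI[of _ _ "\<phi> t"]) (simp_all add: phi_in_L ev_def)
  ultimately show ?thesis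
    using copies_meet_only[OF curve_checks(1)] by (auto simp: ev_def)
qed

lemma meet_23:
  assumes "s \<in> {0..1}" "t \<in> {0..1}" "\<alpha> ^ 3 * \<phi> s - \<alpha>\<^sup>2 = \<alpha> ^ 4 * \<phi> t"
  shows "\<alpha> ^ 4 * \<phi> t = \<alpha> ^ 4 * (1 - \<alpha>)"
proof -
  have "\<alpha> ^ 4 * \<phi> t \<in> arc_set ((0, 0, -1), 3)"
    unfolding arc_set_def assms(3)[symmetric] using assms(1)
    by (intro image_eqI[of _ _ "\<phi> s"]) (simp_all add: phi_in_L ev_def)
  moreover have "\<alpha> ^ 4 * \<phi> t \<in> arc_set ((0, 0, 0), 4)"
    unfolding arc_set_def using assms(2) by (intro image_eqI[of _ _ "\<phi> t"]) (simp_all add: phi_in_L ev_def)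
  ultimately have "\<alpha> ^ 4 * \<phi> t = ev (-1, 0, -2)"
    using copies_meet_only[OF curve_checks(2)] by auto
  also have "\<dots> = \<alpha> ^ 4 * (1 - \<alpha>)"
  proof -
    have "\<alpha> ^ 3 * (1 - \<alpha>) = \<alpha> ^ 3 - \<alpha> ^ 4"
      by (simp add: algebra_simps power_numeral_reduce)
    then show ?thesis
      unfolding joint[symmetric] using alpha_four by (simp add: ev_def)
  qed
  finally show ?thesis .
qed

lemma meet_13:
  assumes "s \<in> {0..1}" "t \<in> {0..1}" shows "\<alpha>\<^sup>2 * \<phi> s - \<delta> \<noteq> \<alpha> ^ 4 * \<phi> t"
proof
  assume eq: "\<alpha>\<^sup>2 * \<phi> s - \<delta> = \<alpha> ^ 4 * \<phi> t"
  have "\<alpha>\<^sup>2 * \<phi> s - \<delta> \<in> arc_set ((1, -1, 0), 2)"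
    unfolding arc_set_def using assms(1) by (intro image_eqI[of _ _ "\<phi> s"]) (simp_all add: phi_in_L ev_def)
  moreover have "\<alpha>\<^sup>2 * \<phi> s - \<delta> \<in> arc_set ((0, 0, 0), 4)"
    unfolding arc_set_def eq using assms(2) by (intro image_eqI[of _ _ "\<phi> t"]) (simp_all add: phi_in_L ev_def)
  ultimately show False
    using copies_meet_only[OF curve_checks(3)] by auto
qed

lemma zero_if_below_powers:
  fixes x :: real
  assumes "0 \<le> x" "\<And>n. x \<le> (1 / 2) ^ n" shows "x = 0"
proof -
  have "x \<le> 0"
    by (rule LIMSEQ_le_const[OF LIMSEQ_power_zero[of "1 / 2 :: real"]]) (use assms in auto)
  then show ?thesis using assms(1) by simp
qed

lemma chord_nz: "- \<alpha>\<^sup>2 \<noteq> 1 - \<alpha>" "\<alpha> \<noteq> 1"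
proof -
  show "- \<alpha>\<^sup>2 \<noteq> 1 - \<alpha>"
  proof
    assume "- \<alpha>\<^sup>2 = 1 - \<alpha>"
    then have 1: "\<alpha>\<^sup>2 = \<alpha> - 1" by (metis minus_diff_eq minus_minus)
    have "\<alpha> * \<alpha>\<^sup>2 = 2 * \<alpha>\<^sup>2 - \<alpha> + 1"
      using alpha_cube by (simp add: power2_eq_square power3_eq_cube mult.assoc)
    then have "\<alpha> * \<alpha> = 2 * \<alpha> - 1"
      unfolding 1 by (simp add: algebra_simps)
    moreover have "\<alpha> * \<alpha> = \<alpha> - 1" using 1 by (simp add: power2_eq_square)
    ultimately show False by simp
  qed
  show "\<alpha> \<noteq> 1" using nonreal by auto
qed

text \<open>Only the third part contains the end point \<open>0\<close>, and there it is again the end point. So the parameter of a zero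
of \<open>\<phi>\<close> has distance from \<open>1\<close> at most \<open>2\<^sup>-\<^sup>n\<close> for every \<open>n\<close>.\<close>

lemma phi_eq_0:
  assumes "t \<in> {0..1}" "\<phi> t = 0" shows "t = 1"
proof -
  have "1 - t \<le> (1 / 2) ^ n" if "t \<in> {0..1}" "\<phi> t = 0" for t n
    using that
  proof (induction n arbitrary: t)
    case (Suc n)
    from Suc.prems(1) show ?case
    proof (cases rule: unit_cases)
      case (1 s)
      then show ?thesis using meet_13[OF 1(1), of 1] phi_1[OF 1(1), folded 1(2)] phi(3) Suc.prems(2) by simp
    next
      case (2 s)
      have "\<alpha> ^ 3 * \<phi> s - \<alpha>\<^sup>2 = \<alpha> ^ 4 * \<phi> 1" using phi_2[OF 2(1), folded 2(2)] phi(3) Suc.prems(2) by simp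
      from meet_23[OF 2(1) _ this] have False using phi(3) chord_nz by auto
      then show ?thesis ..
    next
      case (3 s)
      have "\<phi> s = 0" using phi_3[OF 3(1), folded 3(2)] Suc.prems(2) by simp
      then show ?thesis using Suc.IH[OF 3(1)] 3 by auto
    qed
  qed auto
  then have "1 - t = 0" using assms by (intro zero_if_below_powers) auto
  then show ?thesis by simp
qed

lemma phi_eq_start:
  assumes "t \<in> {0..1}" "\<phi> t = 1 - \<alpha>" shows "t = 0"
  using assms(1)
proof (cases rule: unit_cases)
  case (1 s)
  then have "\<phi> s = 0" using phi_1[OF 1(1), folded 1(2)] assms(2) by simp
  then show ?thesis using phi_eq_0[OF 1(1)] 1(2) by simp
next
  case (2 s)
  have eq: "\<alpha>\<^sup>2 * \<phi> 1 - \<delta> = \<alpha> ^ 3 * \<phi> s - \<alpha>\<^sup>2" using phi_2[OF 2(1), folded 2(2)] phi(3) assms(2) by simp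
  from meet_12[OF _ 2(1) this] have False using phi(3) chord_nz by auto
  then show ?thesis ..
next
  case (3 s)
  then show ?thesis using meet_13[of 1 s] phi_3[OF 3(1), folded 3(2)] phi(3) assms(2) by simp
qed

lemma joint_12:
  assumes "s \<in> {0..1}" "t \<in> {0..1}" "\<alpha>\<^sup>2 * \<phi> s - \<delta> = \<alpha> ^ 3 * \<phi> t - \<alpha>\<^sup>2"
  shows "s = 0 \<and> t = 1"
proof -
  have 1: "\<alpha>\<^sup>2 * \<phi> s - \<delta> = - \<alpha>\<^sup>2" using assms by (rule meet_12)
  then have "\<alpha> ^ 3 * \<phi> t = 0" unfolding assms(3) by simp
  then have "t = 1" using phi_eq_0[OF assms(2)] by simp
  have "\<delta> - \<alpha>\<^sup>2 = \<alpha>\<^sup>2 * (1 - \<alpha>)" using chord_eq by (simp add: algebra_simps)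
  moreover have "\<alpha>\<^sup>2 * \<phi> s = \<delta> - \<alpha>\<^sup>2" using 1 by (simp add: algebra_simps)
  ultimately have "\<alpha>\<^sup>2 * \<phi> s = \<alpha>\<^sup>2 * (1 - \<alpha>)" by simp
  then have "\<phi> s = 1 - \<alpha>" by simp
  then show ?thesis using phi_eq_start[OF assms(1)] \<open>t = 1\<close> by simp
qed

lemma joint_23:
  assumes "s \<in> {0..1}" "t \<in> {0..1}" "\<alpha> ^ 3 * \<phi> s - \<alpha>\<^sup>2 = \<alpha> ^ 4 * \<phi> t"
  shows "s = 0 \<and> t = 0"
proof -
  have 1: "\<alpha> ^ 4 * \<phi> t = \<alpha> ^ 4 * (1 - \<alpha>)" using assms by (rule meet_23)
  then have "t = 0" using phi_eq_start[OF assms(2)] by simp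
  have "\<alpha> ^ 3 * \<phi> s = \<alpha> ^ 3 * (1 - \<alpha>)" using assms(3) unfolding 1 joint[symmetric] by simp
  then show ?thesis using phi_eq_start[OF assms(1)] \<open>t = 0\<close> by simp
qed

text \<open>Two parameters with the same value belong to the same part of the curve, in which case self-similarity
halves the bound for their distance, or to neighbouring parts, in which case both are the common
boundary parameter.\<close>

lemma phi_close:
  assumes "s \<in> {0..1}" "t \<in> {0..1}" "s \<le> t" "\<phi> s = \<phi> t"
  shows "t - s \<le> (1 / 2) ^ n"
  using assms
proof (induction n arbitrary: s t)
  case (Suc n)
  define h :: real where "h = (1 / 2) ^ n"
  have h: "h \<ge> 0" "(1 / 2) ^ Suc n = h / 2" by (simp_all add: h_def)
  have IH: "v - u \<le> h \<and> u - v \<le> h" if "u \<in> {0..1}" "v \<in> {0..1}" "\<phi> u = \<phi> v" for u v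
  proof (cases "u \<le> v")
    case True
    then show ?thesis using Suc.IH[OF that(1,2) True that(3)] h(1) unfolding h_def by linarith
  next
    case False
    then show ?thesis using Suc.IH[OF that(2,1) _ that(3)[symmetric]] h(1) unfolding h_def by linarith
  qed
  have e: "\<phi> s = \<phi> t" by fact
  from Suc.prems(1) show ?case
  proof (cases rule: unit_cases)
    case (1 u)
    note s = 1(2) phi_1[OF 1(1), folded 1(2)]
    from Suc.prems(2) show ?thesis
    proof (cases rule: unit_cases)
      case c1: (1 v)
      then have "\<phi> u = \<phi> v" using e s(2) phi_1[OF c1(1), folded c1(2)] by simp
      from IH[OF 1(1) c1(1) this] have "v - u \<le> h" "u - v \<le> h" by simp_all
      then show ?thesis
        unfolding s(1) c1(2) h(2) using h(1) by (simp add: field_simps)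
    next
      case c2: (2 v)
      have "u = 0 \<and> v = 1"
        using joint_12[OF 1(1) c2(1)] e s(2) phi_2[OF c2(1), folded c2(2)] by simp
      then show ?thesis unfolding s(1) c2(2) by simp
    next
      case c3: (3 v)
      then show ?thesis using meet_13[OF 1(1) c3(1)] e s(2) phi_3[OF c3(1), folded c3(2)] by simp
    qed
  next
    case (2 u)
    note s = 2(2) phi_2[OF 2(1), folded 2(2)]
    from Suc.prems(2) show ?thesis
    proof (cases rule: unit_cases)
      case (1 v)
      then have "s = t" using s(1) 2(1) Suc.prems(3) by (auto simp: field_simps)
      then show ?thesis by simp
    next
      case c2: (2 v)
      then have "\<phi> u = \<phi> v" using e s(2) phi_2[OF c2(1), folded c2(2)] by simp
      from IH[OF 2(1) c2(1) this] have "v - u \<le> h" "u - v \<le> h" by simp_all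
      then show ?thesis
        unfolding s(1) c2(2) h(2) using h(1) by (simp add: field_simps)
    next
      case c3: (3 v)
      have "u = 0 \<and> v = 0"
        using joint_23[OF 2(1) c3(1)] e s(2) phi_3[OF c3(1), folded c3(2)] by simp
      then show ?thesis unfolding s(1) c3(2) by simp
    qed
  next
    case (3 u)
    note s = 3(2) phi_3[OF 3(1), folded 3(2)]
    from Suc.prems(2) show ?thesis
    proof (cases rule: unit_cases)
      case (1 v)
      then have False using s(1) 3(1) Suc.prems(3) by (auto simp: field_simps)
      then show ?thesis ..
    next
      case (2 v)
      then have "s = t" using s(1) 3(1) Suc.prems(3) by (auto simp: field_simps)
      then show ?thesis by simp
    next
      case c3: (3 v)
      then have "\<phi> u = \<phi> v" using e s(2) phi_3[OF c3(1), folded c3(2)] by simp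
      from IH[OF 3(1) c3(1) this] have "v - u \<le> h" "u - v \<le> h" by simp_all
      then show ?thesis
        unfolding s(1) c3(2) h(2) using h(1) by (simp add: field_simps)
    qed
  qed
qed auto

lemma arc_phi: "arc \<phi>"
proof -
  have "s = t" if "s \<in> {0..1}" "t \<in> {0..1}" "s \<le> t" "\<phi> s = \<phi> t" for s t
    using zero_if_below_powers[of "t - s"] phi_close[OF that] that(3) by auto
  then have "inj_on \<phi> {0..1}"
    by (intro inj_onI) (metis linear)
  then show ?thesis using phi(1) by (simp add: arc_def)
qed

end

section \<open>Closed curves and winding numbers of chains\<close>

text \<open>Multiplication by \<open>c\<close> is homotopic to the identity among the linear
automorphisms \<open>z \<mapsto> exp (s Ln c) z\<close> of the punctured plane.\<close>

lemma winding_number_affine: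
  assumes "path \<gamma>" "pathfinish \<gamma> = pathstart \<gamma>" "z \<notin> path_image \<gamma>" "c \<noteq> 0"
  shows "winding_number (\<lambda>t. c * \<gamma> t + d) (c * z + d) = winding_number \<gamma> z"
proof -
  define h where "h = (\<lambda>(s, t). exp (of_real s * Ln c) * (\<gamma> t - z))"
  have cont: "continuous_on {0..1} \<gamma>" using assms(1) by (simp add: path_def)
  have "homotopic_loops (- {0}) (\<lambda>t. \<gamma> t - z) (\<lambda>t. c * (\<gamma> t - z))"
    unfolding homotopic_loops
  proof (intro exI[of _ h] conjI)
    show "continuous_on ({0..1} \<times> {0..1}) h"
      unfolding h_def case_prod_unfold
      by (intro continuous_intros continuous_on_compose2[OF cont]) auto
    show "h \<in> {0..1} \<times> {0..1} \<rightarrow> - {0}"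
      using assms(3) by (auto simp: h_def path_image_def)
    show "\<forall>t\<in>{0..1}. pathfinish (h \<circ> Pair t) = pathstart (h \<circ> Pair t)"
      using assms(2) by (auto simp: h_def pathfinish_def pathstart_def)
  qed (use assms(4) in \<open>auto simp: h_def\<close>)
  then have "winding_number (\<lambda>t. \<gamma> t - z) 0 = winding_number (\<lambda>t. c * (\<gamma> t - z)) 0"
    by (intro winding_number_homotopic_loops) (simp add: Compl_eq_Diff_UNIV)
  then show ?thesis
    by (subst (1 2) winding_number_offset) (simp add: algebra_simps)
qed

lemma times_root_diff: "times_root (p - q) = times_root p - times_root q"
  by (cases p; cases q) simp

lemma times_root_pow_diff: "(times_root ^^ e) (p - q) = (times_root ^^ e) p - (times_root ^^ e) q"
  by (induction e) (simp_all add: times_root_diff)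

lemma times_root_pow_add: "(times_root ^^ e) (p + q) = (times_root ^^ e) p + (times_root ^^ e) q"
  using times_root_pow_diff[of e "p + q" q] by (simp add: algebra_simps)

lemma subdivision_joints:
  "chord k + chord (k + 2) = (times_root ^^ (k + 2)) (1, 0, 0)"
  "(times_root ^^ (k + 2)) (1, 0, 0) + chord (k + 3) = chord (k + 4)"
  unfolding funpow_add o_apply times_root_pow_add[symmetric]
  by (simp_all add: eval_nat_numeral)

lemma shift_ends:
  "step_start (shift e t x) = (times_root ^^ e) (step_start x) + t"
  "step_end (shift e t x) = (times_root ^^ e) (step_end x) + t"
proof -
  have "chord (k + e) = (times_root ^^ e) (chord k)" for k
    by (simp add: funpow_add add.commute[of k])
  then show "step_start (shift e t x) = (times_root ^^ e) (step_start x) + t"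
    "step_end (shift e t x) = (times_root ^^ e) (step_end x) + t"
    by (cases "(e, t, x)" rule: shift.cases; simp add: times_root_pow_diff)+
qed

lemma linked_shift: "linked xs \<Longrightarrow> linked (map (shift e t) xs)"
  by (induction xs rule: linked.induct) (auto simp: shift_ends)

context cubic_root begin

definition seg :: "piece \<Rightarrow> real \<Rightarrow> complex" where
  "seg A = (\<lambda>t. ev (fst A) + \<alpha> ^ snd A * \<phi> t)"

definition step_path :: "step \<Rightarrow> real \<Rightarrow> complex" where
  "step_path x = (if fst x then seg (snd x) else reversepath (seg (snd x)))"

fun joined :: "step list \<Rightarrow> real \<Rightarrow> complex" where
  "joined (x # y # xs) = step_path x +++ joined (y # xs)"
| "joined [x] = step_path x"
| "joined [] = (\<lambda>_. 0)"

definition track :: "step list \<Rightarrow> complex set" where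
  "track xs = (\<Union>x\<in>set xs. arc_set (snd x))"

lemma track_simps [simp]: "track [] = {}" "track (x # xs) = arc_set (snd x) \<union> track xs"
  "track (xs @ ys) = track xs \<union> track ys"
  by (auto simp: track_def)

lemma arc_seg: "arc (seg A)"
proof -
  have "path (seg A)"
    using path_affine[OF phi(1), of "\<alpha> ^ snd A" "- ev (fst A)"] by (simp add: seg_def add.commute)
  moreover have "inj_on (seg A) {0..1}"
    using arc_phi by (auto simp: arc_def seg_def inj_on_def)
  ultimately show ?thesis by (simp add: arc_def)
qed

lemma path_image_seg: "path_image (seg A) = arc_set A"
  by (auto simp: path_image_def arc_set_def seg_def L_eq)

lemma step_path: "arc (step_path x)" "path_image (step_path x) = arc_set (snd x)"
  "pathstart (step_path x) = ev (step_start x)" "pathfinish (step_path x) = ev (step_end x)"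
proof -
  obtain s q k where x: "x = (s, q, k)" by (cases x)
  have "pathstart (seg (q, k)) = ev (q - chord k)" "pathfinish (seg (q, k)) = ev q"
    by (simp_all add: seg_def phi(2,3) pathstart_def pathfinish_def algebra_simps)
  then show "pathstart (step_path x) = ev (step_start x)" "pathfinish (step_path x) = ev (step_end x)"
    by (simp_all add: step_path_def x)
  show "arc (step_path x)" "path_image (step_path x) = arc_set (snd x)"
    by (simp_all add: step_path_def arc_seg arc_reversepath path_image_seg)
qed

lemma path_step: "path (step_path x)"
  using step_path(1) by (rule arc_imp_path)

lemma joined_linked:
  assumes "linked xs" "xs \<noteq> []"
  shows "path (joined xs)" "path_image (joined xs) = track xs"
    "pathstart (joined xs) = ev (step_start (hd xs))" "pathfinish (joined xs) = ev (step_end (last xs))"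
  using assms
  by (induction xs rule: joined.induct) (simp_all add: step_path path_step path_image_join)

lemma arc_joined:
  assumes "linked xs" "chain_ok xs" "xs \<noteq> []"
  shows "arc (joined xs)"
  using assms
proof (induction xs rule: joined.induct)
  case (1 x y xs)
  have "arc_set (snd x) \<inter> arc_set (snd z) = {}" if "z \<in> set xs" for z
    using 1(3) that copies_meet_only[of 3 "snd x" "snd z" "[]"] by (auto simp: list_all_iff)
  then have "arc_set (snd x) \<inter> track xs = {}" unfolding track_def by blast
  moreover have "arc_set (snd x) \<inter> arc_set (snd y) \<subseteq> {ev (step_end x)}"
    using 1(3) copies_meet_only[of 3 "snd x" "snd y" "[step_end x]"] by auto
  ultimately have "arc_set (snd x) \<inter> track (y # xs) \<subseteq> {ev (step_end x)}"
    by auto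
  then show ?case
    using 1 joined_linked[of "y # xs"] by (auto simp: step_path intro!: arc_join)
qed (simp_all add: step_path)

lemma loop_simple:
  assumes "loop_ok xs"
  shows "linked xs" "xs \<noteq> []" "simple_path (joined xs)" "pathfinish (joined xs) = pathstart (joined xs)"
    "path_image (joined xs) = track xs"
proof -
  obtain x y z zs where xs: "xs = x # y # z # zs"
    using assms by (auto simp: loop_ok_def split: list.splits)
  define ys where "ys = z # zs"
  have xs: "xs = x # y # ys" and ys: "ys \<noteq> []" using xs by (auto simp: ys_def)
  have ok: "linked xs" "chain_ok (y # ys)" "step_end (last xs) = step_start x"
    "meet_only 3 (snd x) (snd y) [step_end x]" "meet_only 3 (snd x) (snd (last ys)) [step_start x]"
    "list_all (\<lambda>v. meet_only 3 (snd x) (snd v) []) (butlast ys)"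
    using assms by (auto simp: loop_ok_def xs ys_def)
  show "linked xs" "xs \<noteq> []" using ok(1) xs by auto
  show "path_image (joined xs) = track xs" "pathfinish (joined xs) = pathstart (joined xs)"
    using joined_linked[OF ok(1)] ok(3) by (auto simp: xs)
  have link: "step_end x = step_start y" "linked (y # ys)" using ok(1) by (auto simp: xs)
  have "arc_set (snd x) \<inter> arc_set (snd v) = {}" if "v \<in> set (butlast ys)" for v
    using ok(6) that copies_meet_only[of 3 "snd x" "snd v" "[]"] by (auto simp: list_all_iff)
  then have "arc_set (snd x) \<inter> track (butlast ys) = {}" unfolding track_def by blast
  moreover have "arc_set (snd x) \<inter> arc_set (snd y) \<subseteq> {ev (step_end x)}"
    using copies_meet_only[OF ok(4)] by auto
  moreover have "arc_set (snd x) \<inter> arc_set (snd (last ys)) \<subseteq> {ev (step_start x)}"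
    using copies_meet_only[OF ok(5)] by auto
  moreover have "track ys = track (butlast ys) \<union> arc_set (snd (last ys))"
    using ys by (metis append_butlast_last_id track_simps(1,2,3) sup_bot.right_neutral)
  ultimately have "arc_set (snd x) \<inter> track (y # ys) \<subseteq> {ev (step_start x), ev (step_end x)}"
    by auto
  then have "simple_path (step_path x +++ joined (y # ys))"
    using arc_joined[OF link(2) ok(2)] joined_linked[OF link(2)] ok(3) link(1) ys
    by (intro simple_path_join_loop) (auto simp: step_path xs)
  then show "simple_path (joined xs)" by (simp add: xs)
qed

text \<open>The share of one directed copy in the winding number of a chain. It is in general not an integer, but it
is additive and odd under reversal, which is all that the cancellation argument uses.\<close>

definition turn :: "complex \<Rightarrow> step \<Rightarrow> complex" where
  "turn z x = winding_number (step_path x) z"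

lemma winding_joined:
  assumes "linked xs" "xs \<noteq> []" "z \<notin> track xs"
  shows "winding_number (joined xs) z = sum_list (map (turn z) xs)"
  using assms
proof (induction xs rule: joined.induct)
  case (1 x y xs)
  then have link: "linked (y # xs)" and z: "z \<notin> arc_set (snd x)" "z \<notin> track (y # xs)" by auto
  have "winding_number (step_path x +++ joined (y # xs)) z =
      winding_number (step_path x) z + winding_number (joined (y # xs)) z"
    using joined_linked[OF link] z 1(2)
    by (intro winding_number_join) (simp_all add: path_step step_path)
  then show ?case using 1(1)[OF link _ z(2)] by (simp add: turn_def)
qed (simp_all add: turn_def)

lemma turn_flip: "z \<notin> arc_set (snd x) \<Longrightarrow> turn z (flip x) = - turn z x"
  using arc_imp_path[OF arc_seg]
  by (cases x; cases "fst x") (simp_all add: turn_def step_path_def winding_number_reversepath path_image_seg)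

lemma snd_flip [simp]: "snd (flip x) = snd x"
  by (cases x) auto

text \<open>The functional equation of \<open>\<phi>\<close> presents \<open>q + \<alpha>\<^sup>kL\<close> as the concatenation of its three parts.\<close>

lemma turn_pieces:
  assumes "z \<notin> arc_set A" and P: "pieces A = [X, Y, Z]"
  shows "turn z (True, A) = - turn z (True, X) - turn z (True, Y) + turn z (True, Z)"
proof -
  obtain q k where A: "A = (q, k)" by (cases A)
  have X: "X = (q - chord k, k + 2)" and Y: "Y = (q - (times_root ^^ (k + 2)) (1, 0, 0), k + 3)"
    and Z: "Z = (q, k + 4)" using P by (auto simp: pieces_def A)
  have un: "arc_set A = arc_set X \<union> arc_set Y \<union> arc_set Z"
    unfolding arc_set_pieces[of A] P by auto
  have eq: "seg A t = joined [(False, X), (False, Y), (True, Z)] t" if t: "t \<in> {0..1}" for t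
  proof -
    have "seg A t = ev q + \<alpha> ^ k * subdivide \<phi> t"
      using phi(4)[OF t] by (simp add: seg_def A)
    then show ?thesis
      by (simp add: subdivide_def joinpaths_def step_path_def reversepath_def seg_def X Y Z
          power_add power2_eq_square algebra_simps)
  qed
  have link: "linked [(False, X), (False, Y), (True, Z)]"
    using subdivision_joints[of k] by (simp add: X Y Z algebra_simps)
  have "turn z (True, A) = winding_number (joined [(False, X), (False, Y), (True, Z)]) z"
    unfolding turn_def step_path_def fst_conv snd_conv if_True using eq by (intro winding_number_cong) auto
  also have "\<dots> = turn z (flip (True, X)) + turn z (flip (True, Y)) + turn z (True, Z)"
    using assms(1) un by (subst winding_joined[OF link]) auto
  also have "\<dots> = - turn z (True, X) - turn z (True, Y) + turn z (True, Z)"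
    using assms(1) un by (subst (1 2) turn_flip) auto
  finally show ?thesis .
qed

lemma turn_refine:
  assumes "z \<notin> arc_set (snd x)"
  shows "sum_list (map (turn z) (refine P x)) = turn z x"
proof -
  obtain s A where x: "x = (s, A)" by (cases x)
  obtain X Y Z where P: "pieces A = [X, Y, Z]" by (cases A) (simp add: pieces_def)
  have out: "z \<notin> arc_set A" "z \<notin> arc_set X" "z \<notin> arc_set Y" "z \<notin> arc_set Z"
    using assms unfolding x snd_conv arc_set_pieces[of A] P by auto
  have "turn z (False, B) = - turn z (True, B)" if "z \<notin> arc_set B" for B
    using turn_flip[of z "(True, B)"] that by simp
  then show ?thesis
    using turn_pieces[OF out(1) P] out by (cases s) (simp_all add: x P)
qed

lemma track_refine_all: "track (refine_all P xs) = track xs"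
proof -
  have "track (refine P x) = arc_set (snd x)" for x
  proof -
    obtain s A where x: "x = (s, A)" by (cases x)
    obtain X Y Z where P: "pieces A = [X, Y, Z]" by (cases A) (simp add: pieces_def)
    show ?thesis unfolding x snd_conv arc_set_pieces[of A] by (auto simp: P arc_set_pieces[of A])
  qed
  then show ?thesis unfolding refine_all_def by (induction xs) auto
qed

lemma sum_refine_all:
  "z \<notin> track xs \<Longrightarrow> sum_list (map (turn z) (refine_all P xs)) = sum_list (map (turn z) xs)"
  unfolding refine_all_def by (induction xs) (auto simp: turn_refine)

lemma cancels_sum:
  "cancels xs \<Longrightarrow> z \<notin> track xs \<Longrightarrow> sum_list (map (turn z) xs) = 0"
proof (induction xs rule: cancels.induct)
  case (2 x xs)
  have "track (remove1 (flip x) xs) \<subseteq> track xs"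
    using set_remove1_subset unfolding track_def by fast
  then have "sum_list (map (turn z) (remove1 (flip x) xs)) = 0"
    using 2 by auto
  moreover have "sum_list (map (turn z) xs) = turn z (flip x) + sum_list (map (turn z) (remove1 (flip x) xs))"
    using 2(2) by (intro sum_list_map_remove1) auto
  ultimately show ?case
    using 2(3) by (simp add: turn_flip)
qed simp

lemma sum_flip:
  "z \<notin> track xs \<Longrightarrow> sum_list (map (turn z) (map flip xs)) = - sum_list (map (turn z) xs)"
  by (induction xs) (auto simp: turn_flip)

lemma track_flip: "track (map flip xs) = track xs"
  by (auto simp: track_def)

lemma step_path_shift: "step_path (shift e t x) = (\<lambda>s. \<alpha> ^ e * step_path x s + ev t)"
  by (cases x) (auto simp: step_path_def seg_def reversepath_def power_add algebra_simps)

lemma joined_shift: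
  "xs \<noteq> [] \<Longrightarrow> joined (map (shift e t) xs) = (\<lambda>s. \<alpha> ^ e * joined xs s + ev t)"
  by (induction xs rule: joined.induct) (auto simp: step_path_shift joinpaths_def)

lemma track_shift: "track (map (shift e t) xs) = (\<lambda>w. \<alpha> ^ e * w + ev t) ` track xs"
proof -
  have "arc_set (snd (shift e t x)) = (\<lambda>w. \<alpha> ^ e * w + ev t) ` arc_set (snd x)" for x
    unfolding step_path(2)[symmetric] step_path_shift by (simp add: path_image_def image_image)
  then show ?thesis by (auto simp: track_def)
qed

lemma winding_shift:
  assumes "loop_ok xs" "z \<notin> track xs"
  shows "winding_number (joined (map (shift e t) xs)) (\<alpha> ^ e * z + ev t) = winding_number (joined xs) z"
  using loop_simple[OF assms(1)] assms(2) unfolding joined_shift[OF loop_simple(2)[OF assms(1)]]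
  by (intro winding_number_affine) (auto simp: simple_path_imp_path)

end

section \<open>Regions bounded by the loops\<close>

definition tiles :: "(nat \<times> lat) list \<Rightarrow> step list" where
  "tiles ms = concat (map (\<lambda>(e, t). map (shift e t) loop_B) ms)"

text \<open>In the formal difference of \<open>loop_B\<close> and its three images, some sides face the three parts of
their subdivision on the neighbouring tiles instead of a single side. These are the listed ones; once
they are subdivided, everything cancels in pairs.\<close>

lemma dissection_B:
  "cancels (refine_all [((-1, 2, -1), 0), ((-1, 0, 0), 0), ((0, 1, -1), 0), ((1, -1, 0), 1),
      ((-1, 1, -1), 1), ((-1, 1, -1), 2), ((-1, 2, -1), 3)]
      (loop_B @ map flip (tiles [(1, 0, 0, 0), (2, 1, 0, 0), (4, 0, 1, 1)])))"
  by code_simp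

text \<open>Here the last side of the larger tile is the only one that faces smaller sides.\<close>

lemma dissection_E:
  "cancels (refine_all [((0, 1, -1), 0)]
      (loop_E @ map flip (tiles [(0, 0, 0, 0), (3, 1, 1, 0)])))"
  by code_simp

context cubic_root begin

definition place :: "nat \<times> lat \<Rightarrow> complex \<Rightarrow> complex" where
  "place m w = \<alpha> ^ fst m * w + ev (snd m)"

definition region :: "step list \<Rightarrow> complex set" where
  "region xs = closure (inside (track xs))"

lemma place_image: "place m ` S = (+) (ev (snd m)) ` ((*) (\<alpha> ^ fst m) ` S)"
  by (auto simp: place_def image_image add.commute)

lemma linear_times: "linear ((*) c)" for c :: complex
  by (intro bounded_linear.linear bounded_linear_mult_right)

lemma inj_times: "inj ((*) (\<alpha> ^ k))"
  by (auto simp: inj_on_def)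

lemma interior_place: "interior (place m ` S) = place m ` interior S"
  unfolding place_image interior_translation
  using interior_injective_linear_image[OF linear_times inj_times] by simp

lemma closure_place: "closure (place m ` S) = place m ` closure S"
  unfolding place_image closure_translation
  using closure_injective_linear_image[OF linear_times inj_times] by simp

lemma loop_facts:
  assumes "loop_ok xs"
  shows "open (inside (track xs))" "inside (track xs) \<noteq> {}" "bounded (inside (track xs))"
    "closed (track xs)" "interior (track xs) = {}" "frontier (region xs) = track xs"
proof -
  note l = loop_simple[OF assms]
  note J = Jordan_inside_outside[OF l(3,4), unfolded l(5)]
  show op: "open (inside (track xs))" and "inside (track xs) \<noteq> {}" "bounded (inside (track xs))"
    using J by auto
  show cl: "closed (track xs)"
    using closed_path_image[OF simple_path_imp_path[OF l(3)]] l(5) by simp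
  show "interior (track xs) = {}"
  proof -
    define W where "W = interior (track xs)"
    have "W \<inter> inside (track xs) = {}"
      using interior_subset[of "track xs"] inside_no_overlap[of "track xs"] unfolding W_def by blast
    then have "W \<inter> closure (inside (track xs)) = {}"
      by (simp add: W_def open_Int_closure_eq_empty)
    moreover have "W \<subseteq> closure (inside (track xs))"
      using interior_subset[of "track xs"] J unfolding W_def frontier_def by blast
    ultimately show ?thesis unfolding W_def by blast
  qed
  have "closure (inside (track xs)) = inside (track xs) \<union> track xs"
    using J by (metis closure_Un_frontier)
  also have "\<dots> = - outside (track xs)"
    using inside_Un_outside[of "track xs"] inside_Int_outside[of "track xs"] outside_no_overlap[of "track xs"]
    by blast
  finally show "frontier (region xs) = track xs"
    using J by (simp add: region_def frontier_complement)
qed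

lemma winding_sign:
  assumes "loop_ok xs"
  obtains s where "s \<noteq> 0"
    "\<And>z. z \<notin> track xs \<Longrightarrow> winding_number (joined xs) z = (if z \<in> inside (track xs) then s else 0)"
proof -
  note l = loop_simple[OF assms]
  have out: "winding_number (joined xs) z = 0" if "z \<notin> track xs" "z \<notin> inside (track xs)" for z
    using winding_number_zero_in_outside[OF simple_path_imp_path[OF l(3)] l(4), of z]
      that inside_Un_outside[of "track xs"] l(5) by (metis ComplI Un_iff)
  consider "\<And>z. z \<in> inside (track xs) \<Longrightarrow> winding_number (joined xs) z = 1"
    | "\<And>z. z \<in> inside (track xs) \<Longrightarrow> winding_number (joined xs) z = -1"
    using simple_closed_path_winding_number_inside[OF l(3)] unfolding l(5) by metis
  then show thesis
  proof cases
    case 1 then show thesis using out by (intro that[of 1]) auto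
  next
    case 2 then show thesis using out by (intro that[of "-1"]) auto
  qed
qed

text \<open>All images of \<open>loop_B\<close> wind around their interior points with the same nonzero number \<open>s\<close>, so
contributions of different images cannot cancel each other.\<close>

lemma sum_tiles:
  assumes ok: "loop_ok loop_B" and s: "s \<noteq> 0"
    "\<And>z. z \<notin> track loop_B \<Longrightarrow> winding_number (joined loop_B) z = (if z \<in> inside (track loop_B) then s else 0)"
    and z: "z \<notin> track (tiles ms)"
  shows "\<exists>n. sum_list (map (turn z) (tiles ms)) = of_nat n * s \<and>
    (n \<noteq> 0 \<longleftrightarrow> (\<exists>m\<in>set ms. z \<in> place m ` inside (track loop_B)))"
  using z
proof (induction ms)
  case (Cons m ms)
  obtain e t where m: "m = (e, t)" by (cases m)
  have tiles: "tiles (m # ms) = map (shift e t) loop_B @ tiles ms" by (simp add: tiles_def m)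
  have z: "z \<notin> track (map (shift e t) loop_B)" "z \<notin> track (tiles ms)"
    using Cons.prems by (auto simp: tiles)
  obtain n where n: "sum_list (map (turn z) (tiles ms)) = of_nat n * s"
    "n \<noteq> 0 \<longleftrightarrow> (\<exists>m\<in>set ms. z \<in> place m ` inside (track loop_B))"
    using Cons.IH[OF z(2)] by blast
  define y where "y = (z - ev t) / \<alpha> ^ e"
  have zy: "z = \<alpha> ^ e * y + ev t" by (simp add: y_def)
  have pl: "z \<in> place m ` S \<longleftrightarrow> y \<in> S" for S
    by (auto simp: place_def m zy)
  have y: "y \<notin> track loop_B" using z(1) by (auto simp: track_shift zy)
  have "sum_list (map (turn z) (map (shift e t) loop_B)) = winding_number (joined (map (shift e t) loop_B)) z"
    using winding_joined[OF linked_shift[OF loop_simple(1)[OF ok]] _ z(1)] loop_simple(2)[OF ok] by simp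
  also have "\<dots> = (if y \<in> inside (track loop_B) then s else 0)"
    unfolding zy winding_shift[OF ok y] using s(2)[OF y] .
  finally show ?case
    using n pl[of "inside (track loop_B)"] unfolding tiles map_append sum_list.append
    by (intro exI[of _ "(if y \<in> inside (track loop_B) then 1 else 0) + n"]) (simp add: algebra_simps)
qed (simp add: tiles_def)

text \<open>Off the curves, lying inside the loop means lying inside one of the images of \<open>loop_B\<close>, since both
are detected by the same sum of winding numbers. The curves are closed and nowhere dense, so the open
insides have the same closure with and without them.\<close>

lemma region_dissection:
  assumes ok: "loop_ok xs" and c: "cancels (refine_all P (xs @ map flip (tiles ms)))"
  shows "region xs = (\<Union>m\<in>set ms. place m ` region loop_B)"
proof -
  define N where "N = track xs \<union> track (tiles ms)"
  define V where "V = (\<Union>m\<in>set ms. place m ` inside (track loop_B))"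
  have B: "loop_ok loop_B" by (rule loop_B_ok)
  obtain s where s: "s \<noteq> 0"
    "\<And>z. z \<notin> track loop_B \<Longrightarrow> winding_number (joined loop_B) z = (if z \<in> inside (track loop_B) then s else 0)"
    using winding_sign[OF B] by blast
  obtain r where r: "r \<noteq> 0"
    "\<And>z. z \<notin> track xs \<Longrightarrow> winding_number (joined xs) z = (if z \<in> inside (track xs) then r else 0)"
    using winding_sign[OF ok] by blast
  have eq: "z \<in> inside (track xs) \<longleftrightarrow> z \<in> V" if "z \<notin> N" for z
  proof -
    have z: "z \<notin> track xs" "z \<notin> track (tiles ms)" using that by (auto simp: N_def)
    have "z \<notin> track (xs @ map flip (tiles ms))" using z by (simp add: track_flip)
    then have "sum_list (map (turn z) (xs @ map flip (tiles ms))) = 0"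
      using cancels_sum[OF c, of z] sum_refine_all[of z "xs @ map flip (tiles ms)" P] by (simp add: track_refine_all)
    then have "sum_list (map (turn z) xs) = sum_list (map (turn z) (tiles ms))"
      using sum_flip[OF z(2)] by simp
    then have w: "winding_number (joined xs) z = sum_list (map (turn z) (tiles ms))"
      using winding_joined[OF loop_simple(1,2)[OF ok] z(1)] by simp
    obtain k where "sum_list (map (turn z) (tiles ms)) = of_nat k * s"
      "k \<noteq> 0 \<longleftrightarrow> (\<exists>m\<in>set ms. z \<in> place m ` inside (track loop_B))"
      using sum_tiles[OF B s z(2)] by blast
    then show ?thesis
      using w r(1) r(2)[OF z(1)] s(1) by (auto simp: V_def split: if_splits)
  qed
  have tr: "track (tiles ms) = (\<Union>m\<in>set ms. place m ` track loop_B)"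
    by (induction ms) (auto simp: tiles_def track_shift place_def)
  have "closed (track (tiles ms)) \<and> interior (track (tiles ms)) = {}"
    unfolding tr
  proof (induction ms)
    case (Cons m ms)
    have "closed (place m ` track loop_B)"
      using closure_place[of m "track loop_B"] loop_facts(4)[OF B] by (metis closure_closed closed_closure)
    moreover have "interior (place m ` track loop_B) = {}"
      unfolding interior_place loop_facts(5)[OF B] by simp
    ultimately show ?case
      using Cons interior_closed_Un_empty_interior[of "place m ` track loop_B"]
      by (simp add: closed_Un)
  qed simp
  then have "closed N" "interior N = {}"
    using loop_facts(4,5)[OF ok] interior_closed_Un_empty_interior[of "track xs" "track (tiles ms)"]
    by (auto simp: N_def)
  then have dense: "closure (- N) = UNIV" by (simp add: closure_complement)
  have trim: "closure (U \<inter> - N) = closure U" if "open U" for U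
    using that dense by (intro closure_open_Int_superset) auto
  have "open V"
    unfolding V_def using loop_facts(1)[OF B] interior_place
    by (intro open_UN) (metis interior_open interior_eq)
  have "inside (track xs) \<inter> - N = V \<inter> - N" using eq by auto
  then have "region xs = closure V"
    unfolding region_def using trim[OF loop_facts(1)[OF ok]] trim[OF \<open>open V\<close>] by simp
  also have "\<dots> = (\<Union>m\<in>set ms. place m ` region loop_B)"
    unfolding V_def region_def closure_place[symmetric] by (induction ms) simp_all
  finally show ?thesis .
qed

definition B where "B = region loop_B"

lemma B_eq: "B = (\<lambda>w. \<alpha> * w) ` B \<union> (\<lambda>w. 1 + \<alpha>\<^sup>2 * w) ` B \<union> (\<lambda>w. \<alpha> + \<alpha>\<^sup>2 + \<alpha> ^ 4 * w) ` B"
proof -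
  have "B = (\<Union>m\<in>set [(1, 0, 0, 0), (2, 1, 0, 0), (4, 0, 1, 1)]. place m ` B)"
    unfolding B_def by (rule region_dissection[OF loop_B_ok dissection_B])
  then show ?thesis
    by (simp add: place_def ev_def Un_assoc add.commute)
qed

lemma E_eq: "region loop_E = B \<union> (\<lambda>w. 1 + \<alpha> + \<alpha> ^ 3 * w) ` B"
proof -
  have "region loop_E = (\<Union>m\<in>set [(0, 0, 0, 0), (3, 1, 1, 0)]. place m ` B)"
    unfolding B_def by (rule region_dissection[OF loop_E_ok dissection_E])
  then show ?thesis
    by (simp add: place_def ev_def add.commute)
qed

end

section \<open>Digit sequences\<close>

lemma window_iff:
  "([d, x, y, z], [1, 1, 0, 1 :: nat]) \<in> lexord less_than \<longleftrightarrow>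
     d = 0 \<or> d = 1 \<and> (x = 0 \<or> x = 1 \<and> y = 0 \<and> z = 0)"
  by auto

text \<open>The state of the automaton after the digits \<open>x\<close>, \<open>y\<close>, \<open>z\<close>, the most recent first: \<open>0\<close> after \<open>00\<close>, \<open>1\<close> after
\<open>001\<close>, \<open>2\<close> after \<open>10\<close>, and \<open>3\<close> after \<open>11\<close> or \<open>101\<close> (in order of reading). Only in state \<open>3\<close>
is the digit \<open>1\<close> forbidden.\<close>

definition memory :: "nat \<Rightarrow> nat \<Rightarrow> nat \<Rightarrow> nat" where
  "memory x y z = (if x = 0 then (if y = 0 then 0 else 2) else if y = 1 \<or> z = 1 then 3 else 1)"

context cubic_root begin

text \<open>The values \<open>\<Sum>d\<^sub>k\<alpha>\<^sup>k\<close> of the digit sequences that may follow a given state, expressed by the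
regions; that they are these values is the content of \<open>R2_eq\<close>.\<close>

definition tail :: "nat \<Rightarrow> complex set" where
  "tail s = (if s = 0 then region loop_E
     else if s = 1 then (\<lambda>w. \<alpha> * w) ` B \<union> (\<lambda>w. 1 + \<alpha>\<^sup>2 * w) ` B
     else if s = 2 then B else (\<lambda>w. \<alpha> * w) ` B)"

text \<open>The three maps in \<open>B_eq\<close> prepend the digit blocks \<open>0\<close>, \<open>10\<close> and \<open>0110\<close>; the other states
split these blocks into single digits.\<close>

lemma tail_step:
  assumes "x \<in> {0, 1}" "y \<in> {0, 1}" "z \<in> {0, 1}"
  shows "w \<in> tail (memory x y z) \<longleftrightarrow>
    (\<exists>d\<in>{0, 1}. ([d, x, y, z], [1, 1, 0, 1 :: nat]) \<in> lexord less_than \<and>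
       (\<exists>v\<in>tail (memory d x y). w = of_nat d + \<alpha> * v))"
proof -
  have ex: "(\<exists>v\<in>f ` S. P v) \<longleftrightarrow> (\<exists>v\<in>S. P (f v))" for f :: "complex \<Rightarrow> complex" and S P by auto
  have BE: "w \<in> B \<longleftrightarrow> (\<exists>v\<in>B. w = \<alpha> * v) \<or> (\<exists>v\<in>B. w = 1 + \<alpha>\<^sup>2 * v) \<or> (\<exists>v\<in>B. w = \<alpha> + \<alpha>\<^sup>2 + \<alpha> ^ 4 * v)"
    by (subst B_eq) auto
  have p: "\<alpha> * (\<alpha> * v) = \<alpha>\<^sup>2 * v" "\<alpha> * (\<alpha>\<^sup>2 * v) = \<alpha> ^ 3 * v" "\<alpha> * (\<alpha> ^ 3 * v) = \<alpha> ^ 4 * v"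
    "\<alpha> * \<alpha> = \<alpha>\<^sup>2" for v
    by (simp_all add: power_numeral_reduce)
  show ?thesis
    using assms BE unfolding window_iff
    by (auto simp: tail_def memory_def E_eq bex_Un ex distrib_left p add.assoc)
qed

lemma B_props: "B \<noteq> {}" "bounded B" "closed (region loop_E)"
  using loop_facts[OF loop_B_ok] by (auto simp: B_def region_def bounded_closure)

lemma tail_props: "tail s \<noteq> {}" "\<exists>C. \<forall>s. \<forall>w\<in>tail s. cmod w \<le> C"
proof -
  show "tail s \<noteq> {}" using B_props(1) by (auto simp: tail_def E_eq)
  obtain M where M: "\<And>w. w \<in> B \<Longrightarrow> cmod w \<le> M" using B_props(2) by (auto simp: bounded_iff)
  have le: "cmod (c + \<alpha> ^ k * w) \<le> cmod c + M" if "w \<in> B" for c k w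
  proof -
    have "cmod (c + \<alpha> ^ k * w) \<le> cmod c + cmod \<alpha> ^ k * cmod w"
      by (rule order_trans[OF norm_triangle_ineq]) (simp add: norm_mult norm_power)
    also have "cmod \<alpha> ^ k * cmod w \<le> 1 * M"
      using M[OF that] cmod_alpha_lt_1 by (intro mult_mono) (auto intro: power_le_one)
    finally show ?thesis by simp
  qed
  have "cmod w \<le> 1 + cmod (1 + \<alpha>) + M" if "w \<in> tail s" for s w
  proof -
    consider "w \<in> B" | v where "v \<in> B" "w = \<alpha> * v" | v where "v \<in> B" "w = 1 + \<alpha>\<^sup>2 * v"
      | v where "v \<in> B" "w = 1 + \<alpha> + \<alpha> ^ 3 * v"
      using \<open>w \<in> tail s\<close> by (auto simp: tail_def E_eq split: if_splits)
    then show ?thesis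
    proof cases
      case 1
      then show ?thesis using M[of w] norm_ge_zero[of "1 + \<alpha>"] by linarith
    next
      case 2
      then have "cmod w \<le> M" using le[of v 0 1] by simp
      then show ?thesis using norm_ge_zero[of "1 + \<alpha>"] by linarith
    next
      case 3
      then have "cmod w \<le> 1 + M" using le[of v 1 2] by simp
      then show ?thesis using norm_ge_zero[of "1 + \<alpha>"] by linarith
    next
      case 4
      then show ?thesis using le[of v "1 + \<alpha>" 3] by simp
    qed
  qed
  then show "\<exists>C. \<forall>s. \<forall>w\<in>tail s. cmod w \<le> C" by blast
qed

lemma tail_vanishes:
  assumes "\<And>n. x n \<in> tail (s n)" shows "(\<lambda>n. \<alpha> ^ n * x n) \<longlonglongrightarrow> 0"
proof -
  obtain C where "\<And>n. cmod (x n) \<le> C" using tail_props(2) assms by blast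
  then have "eventually (\<lambda>n. norm (x n) \<le> C) sequentially" by simp
  moreover have "(\<lambda>n. \<alpha> ^ n) \<longlonglongrightarrow> 0" using cmod_alpha_lt_1 by (rule LIMSEQ_power_zero)
  ultimately show ?thesis
    by (intro lim_null_mult_right_bounded)
qed

text \<open>For a given admissible sequence, completing each partial sum by a point of the current \<open>tail\<close>
yields points of the region that converge to the value of the sequence. Conversely, \<open>tail_step\<close> reads
off digits from a point of the region one after the other; the remainders are bounded, so the digit
series converges to the point.\<close>

lemma R2_eq: "R2 \<alpha> = (\<lambda>w. \<alpha>\<^sup>2 * w) ` region loop_E"
proof (intro equalityI subsetI)
  fix z assume "z \<in> R2 \<alpha>"
  then obtain \<epsilon> where adm: "admissible \<epsilon>" and z: "(\<lambda>k. of_nat (\<epsilon> (int k + 2)) * \<alpha> ^ (k + 2)) sums z"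
    by (auto simp: R2_def)
  have digit: "\<epsilon> i \<in> {0, 1}" if "i \<ge> -1" for i
  proof -
    have "i = -1 \<or> i = 0 \<or> i = 1 \<or> i \<ge> 2" using that by arith
    then show ?thesis using adm by (elim disjE) (auto simp: admissible_def)
  qed
  define s where "s n = memory (\<epsilon> (int n + 1)) (\<epsilon> (int n)) (\<epsilon> (int n - 1))" for n
  define S where "S n = (\<Sum>k<n. of_nat (\<epsilon> (int k + 2)) * \<alpha> ^ k)" for n
  have mem: "S n + \<alpha> ^ n * w \<in> region loop_E" if "w \<in> tail (s n)" for n w
    using that
  proof (induction n arbitrary: w)
    case 0
    then show ?case using adm by (simp add: S_def s_def admissible_def memory_def tail_def)
  next
    case (Suc n)
    have "([\<epsilon> (int n + 2), \<epsilon> (int n + 1), \<epsilon> (int n), \<epsilon> (int n - 1)], [1, 1, 0, 1]) \<in> lexord less_than"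
    proof -
      have "int n + 2 - 1 = int n + 1" "int n + 2 - 2 = int n" "int n + 2 - 3 = int n - 1" "2 \<le> int n + 2"
        by simp_all
      then show ?thesis using adm unfolding admissible_def by metis
    qed
    then have "of_nat (\<epsilon> (int n + 2)) + \<alpha> * w \<in> tail (s n)"
      using Suc.prems digit[of "int n + 2"] digit[of "int n + 1"] digit[of "int n"] digit[of "int n - 1"]
      unfolding s_def by (subst tail_step) (auto simp: add.commute)
    from Suc.IH[OF this] show ?case by (simp add: S_def algebra_simps)
  qed
  define x where "x n = (SOME w. w \<in> tail (s n))" for n
  have x: "x n \<in> tail (s n)" for n
    using tail_props(1) by (simp add: x_def some_in_eq)
  have "(\<lambda>k. of_nat (\<epsilon> (int k + 2)) * \<alpha> ^ k * \<alpha>\<^sup>2) sums z"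
    using z by (simp add: power_add power2_eq_square mult_ac)
  then have "(\<lambda>k. of_nat (\<epsilon> (int k + 2)) * \<alpha> ^ k * \<alpha>\<^sup>2 / \<alpha>\<^sup>2) sums (z / \<alpha>\<^sup>2)"
    by (rule sums_divide)
  then have "S \<longlonglongrightarrow> z / \<alpha>\<^sup>2"
    by (simp add: sums_def S_def[abs_def])
  then have "(\<lambda>n. S n + \<alpha> ^ n * x n) \<longlonglongrightarrow> z / \<alpha>\<^sup>2 + 0"
    by (intro tendsto_add tail_vanishes[OF x])
  then have "z / \<alpha>\<^sup>2 + 0 \<in> region loop_E"
    by (rule closed_sequentially[OF B_props(3) mem[OF x]])
  then show "z \<in> (\<lambda>w. \<alpha>\<^sup>2 * w) ` region loop_E"
    by (intro image_eqI[of _ _ "z / \<alpha>\<^sup>2"]) auto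
next
  fix z assume "z \<in> (\<lambda>w. \<alpha>\<^sup>2 * w) ` region loop_E"
  then obtain w0 where w0: "w0 \<in> region loop_E" "z = \<alpha>\<^sup>2 * w0" by auto
  define P where "P = (\<lambda>(w, x, y, u). x \<in> {0, 1} \<and> y \<in> {0, 1} \<and> u \<in> {0, 1 :: nat} \<and> w \<in> tail (memory x y u))"
  define Q where "Q = (\<lambda>(w, x, y, u) (w', x', y', u').
     w = of_nat x' + \<alpha> * w' \<and> y' = x \<and> u' = y \<and> ([x', x, y, u], [1, 1, 0, 1 :: nat]) \<in> lexord less_than)"
  have "\<exists>f. f 0 = (w0, 0, 0, 0) \<and> (\<forall>n. P (f n) \<and> Q (f n) (f (Suc n)))"
  proof -
    have "\<exists>f. \<forall>n. (P (f n) \<and> (n = 0 \<longrightarrow> f n = (w0, 0, 0, 0))) \<and> Q (f n) (f (Suc n))"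
    proof (rule dependent_nat_choice)
      show "\<exists>f. P f \<and> (0 = (0 :: nat) \<longrightarrow> f = (w0, 0, 0, 0))"
        using w0(1) by (auto simp: P_def memory_def tail_def)
    next
      fix f and n :: nat assume "P f \<and> (n = 0 \<longrightarrow> f = (w0, 0, 0, 0))"
      moreover obtain w x y u where f: "f = (w, x, y, u)" by (cases f)
      ultimately have xyu: "x \<in> {0, 1}" "y \<in> {0, 1}" "u \<in> {0, 1}" "w \<in> tail (memory x y u)"
        by (auto simp: P_def)
      then obtain d v where "d \<in> {0, 1}" "([d, x, y, u], [1, 1, 0, 1]) \<in> lexord less_than"
        "v \<in> tail (memory d x y)" "w = of_nat d + \<alpha> * v"
        using tail_step[OF xyu(1-3)] by blast
      then show "\<exists>g. (P g \<and> (Suc n = 0 \<longrightarrow> g = (w0, 0, 0, 0))) \<and> Q f g"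
        using xyu by (intro exI[of _ "(v, d, x, y)"]) (simp add: P_def Q_def f)
    qed
    then show ?thesis by blast
  qed
  then obtain f where f0: "f 0 = (w0, 0, 0, 0)" and f: "\<And>n. P (f n)" "\<And>n. Q (f n) (f (Suc n))"
    by blast
  define W X Y U where "W n = fst (f n)" and "X n = fst (snd (f n))"
    and "Y n = fst (snd (snd (f n)))" and "U n = snd (snd (snd (f n)))" for n
  have fn: "f n = (W n, X n, Y n, U n)" for n by (simp add: W_def X_def Y_def U_def)
  have init: "W 0 = w0" "X 0 = 0" "Y 0 = 0" "U 0 = 0" using f0 by (simp_all add: W_def X_def Y_def U_def)
  have Pn: "X n \<in> {0, 1}" "W n \<in> tail (memory (X n) (Y n) (U n))" for n
    using f(1)[of n] by (simp_all add: fn P_def)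
  have Qn: "W n = of_nat (X (Suc n)) + \<alpha> * W (Suc n)" "Y (Suc n) = X n" "U (Suc n) = Y n"
    "([X (Suc n), X n, Y n, U n], [1, 1, 0, 1]) \<in> lexord less_than" for n
    using f(2)[of n] by (simp_all add: fn Q_def)
  (* Truncated subtraction is intended: the digits before the first one are 0, like X 0. *)
  have Yn: "Y n = X (n - 1)" for n using Qn(2) init by (cases n) auto
  have Un: "U n = X (n - 2)" for n using Qn(3) Yn init by (cases n) auto
  (* The truncation in nat makes this 0 at the indices 1, 0 and -1. *)
  define \<epsilon> where "\<epsilon> i = X (nat (i - 1))" for i
  have "admissible \<epsilon>"
    unfolding admissible_def
  proof (intro conjI allI impI)
    fix i :: int assume i: "i \<ge> 2"
    define n where "n = nat (i - 2)"
    have "nat (i - 1) = Suc n" "nat (i - 1 - 1) = n" "nat (i - 2 - 1) = n - 1" "nat (i - 3 - 1) = n - 2"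
      using i by (auto simp: n_def)
    then show "([\<epsilon> i, \<epsilon> (i - 1), \<epsilon> (i - 2), \<epsilon> (i - 3)], [1, 1, 0, 1]) \<in> lexord less_than"
      using Qn(4)[of n] by (simp add: \<epsilon>_def Yn Un)
  qed (use Pn(1) init in \<open>auto simp: \<epsilon>_def\<close>)
  have part: "w0 = (\<Sum>k<n. of_nat (X (Suc k)) * \<alpha> ^ k) + \<alpha> ^ n * W n" for n
  proof (induction n)
    case (Suc n)
    then show ?case using Qn(1)[of n] by (simp add: algebra_simps)
  qed (simp add: init)
  have "(\<lambda>n. w0 - \<alpha> ^ n * W n) \<longlonglongrightarrow> w0 - 0"
    by (intro tendsto_diff tendsto_const tail_vanishes[OF Pn(2)])
  moreover have "(\<lambda>n. w0 - \<alpha> ^ n * W n) = (\<lambda>n. \<Sum>k<n. of_nat (X (Suc k)) * \<alpha> ^ k)"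
    using part by (auto simp: fun_eq_iff algebra_simps)
  ultimately have "(\<lambda>k. of_nat (X (Suc k)) * \<alpha> ^ k) sums w0"
    by (simp add: sums_def)
  then have "(\<lambda>k. \<alpha>\<^sup>2 * (of_nat (X (Suc k)) * \<alpha> ^ k)) sums z"
    unfolding w0(2) by (rule sums_mult)
  moreover have "\<epsilon> (int k + 2) = X (Suc k)" for k
    by (simp add: \<epsilon>_def nat_add_distrib)
  ultimately have "(\<lambda>k. of_nat (\<epsilon> (int k + 2)) * \<alpha> ^ (k + 2)) sums z"
    by (simp add: power_add power2_eq_square mult_ac)
  then show "z \<in> R2 \<alpha>" using \<open>admissible \<epsilon>\<close> by (auto simp: R2_def)
qed

lemma boundary: "frontier (R2 \<alpha>) homeomorphic sphere (0 :: complex) 1"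
proof -
  have lin: "R2 \<alpha> homeomorphic region loop_E"
    unfolding R2_eq using homeomorphic_sym linear_homeomorphic_image[OF linear_times inj_times[of 2]] by blast
  have "closed (R2 \<alpha>)"
    unfolding R2_eq using B_props(3) closed_injective_linear_image[OF _ linear_times inj_times[of 2]] by simp
  have "inside (track loop_E) \<subseteq> interior (region loop_E)"
    using loop_facts(1)[OF loop_E_ok] by (simp add: region_def closure_subset interior_maximal)
  then have int: "interior (region loop_E) \<noteq> {}"
    using loop_facts(2)[OF loop_E_ok] by blast
  have "interior (R2 \<alpha>) = (*) (\<alpha>\<^sup>2) ` interior (region loop_E)"
    unfolding R2_eq by (rule interior_injective_linear_image[OF linear_times inj_times])
  then have "frontier (R2 \<alpha>) homeomorphic frontier (region loop_E)"
    using lin \<open>closed (R2 \<alpha>)\<close> B_props(3) int by (intro homeomorphic_frontiers) auto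
  also have "frontier (region loop_E) = path_image (joined loop_E)"
    using loop_facts(6)[OF loop_E_ok] loop_simple(5)[OF loop_E_ok] by simp
  also have "path_image (joined loop_E) homeomorphic sphere (0 :: complex) 1"
    using loop_simple(3,4)[OF loop_E_ok] by (intro homeomorphic_simple_path_image_circle) auto
  finally (homeomorphic_trans) show ?thesis .
qed

end

theorem mainTheorem3:
  fixes \<alpha> :: complex
  assumes "\<alpha> ^ 3 - 2 * \<alpha> ^ 2 + \<alpha> - 1 = 0" and "\<alpha> \<notin> \<real>"
  shows "frontier (R2 \<alpha>) homeomorphic sphere (0::complex) 1"
  using assms by (intro cubic_root.boundary cubic_root.intro)

end
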